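(* The nerve functor $N:\mathsf{PM}\to\mathsf{Set}_\Delta$, $N(M)_n=\mathrm{Hom}_{\mathsf{PM}}(\mathfrak D^n,M)$, from partial monoids to simplicial sets, is fully faithful, and its essential image consists of those simplicial sets which are spiny, reduced, and 2-Segal.
   Context: A partial unital magma $(M,\cdot,1)$ is a set $M$ with a partially defined binary operation $\cdot$ (pairs in its domain are called multiplicable) and an element $1\in M$ such that for every $m\in M$ the pairs $(m,1),(1,m)$ are multiplicable and $m\cdot 1=m=1\cdot m$. A binary bracketing of $n\ge2$ is a planar binary rooted tree $T$ with $n$ leaves; it gives a partially defined operation $\cdot^T:M^{\times n}\to M$. A tuple in $M^{\times n}$ is multiplicable if it lies in the domain of $\cdot^T$ for every bracketing $T$. A partial monoid is a partial unital magma such that (i) for every multiplicable tuple all bracketed products agree, and (ii) an $n$-tuple is multiplicable as soon as it lies in the domain of $\cdot^T$ for at least one $T$. Equivalently: $(a\cdot b)\cdot c$ is defined if and only if $a\cdot(b\cdot c)$ is, and then both are equal. Morphisms in $\mathsf{PM}$ are maps of sets $f$ with $f(1)=1$ such that if $(m,n)$ is multiplicable then so is $(f(m),f(n))$ and $f(m\cdot n)=f(m)\cdot f(n)$. $\mathfrak D^n$ is the partial monoid with non-identity elements $m_{i,j}$, $0\le i<j\le n$, and identity $1$, where the multiplicable pairs of non-identity elements are $(m_{i,j},m_{j,k})$ with $i<j<k$, and $m_{i,j}\cdot m_{j,k}=m_{i,k}$. A monotone map $\phi:[n]\to[k]$ induces $m_{i,j}\mapsto m_{\phi(i),\phi(j)}$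 with $m_{i,i}=1$, making $\mathfrak D^\bullet$ a cosimplicial object. A simplicial set $X$ is reduced if $X_0$ is a singleton. It is spiny if for all $n\ge2$ the map $X_n\to X_1\times_{X_0}\cdots\times_{X_0}X_1$ given by restriction to the spine of $\Delta^n$ (the edges $\{i,i+1\}$) is injective. For $n\ge3$ let $P_{n+1}$ be a planar convex $(n+1)$-gon with vertices labelled $0,1,\dots,n$ counterclockwise; for a triangulation $\mathscr T$ of $P_{n+1}$ (with no new vertices), let $\Delta^{\mathscr T}\subset\Delta^n$ be the simplicial subset generated by the 2-simplices $\Delta^{\{i,j,k\}}$ with $\{i,j,k\}$ a triangle of $\mathscr T$. $X$ is 2-Segal if for every $n\ge3$ and every triangulation $\mathscr T$ of $P_{n+1}$ the restriction map $X_n\to\mathrm{Hom}_{\mathsf{Set}_\Delta}(\Delta^{\mathscr T},X)$ is a bijection. *)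

theory Defs
  imports "HOL-Analysis.Analysis"
begin

section \<open>Partial monoids\<close>

text \<open>The partial operation is option-valued: a pair is multiplicable iff its value is not
  \<^const>\<open>None\<close>.\<close>

record 'a pmagma =
  elems :: "'a set"
  pone :: 'a
  pmul :: "'a \<Rightarrow> 'a \<Rightarrow> 'a option"

definition partial_unital_magma :: "'a pmagma \<Rightarrow> bool" where
  "partial_unital_magma M \<longleftrightarrow>
     pone M \<in> elems M \<and>
     (\<forall>a b c. pmul M a b = Some c \<longrightarrow> a \<in> elems M \<and> b \<in> elems M \<and> c \<in> elems M) \<and>
     (\<forall>m\<in>elems M. pmul M m (pone M) = Some m \<and> pmul M (pone M) m = Some m)"

text \<open>Planar binary rooted trees.\<close>

datatype bracketing = Leaf | Node bracketing bracketing

primrec leaves :: "bracketing \<Rightarrow> nat" where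
  "leaves Leaf = 1"
| "leaves (Node l r) = leaves l + leaves r"

text \<open>The operation \<open>\<cdot>\<^sup>T\<close>, meaningful on lists whose length is the number of leaves.\<close>

primrec bracket_mul :: "'a pmagma \<Rightarrow> bracketing \<Rightarrow> 'a list \<Rightarrow> 'a option" where
  "bracket_mul M Leaf xs = Some (hd xs)"
| "bracket_mul M (Node l r) xs =
     Option.bind (bracket_mul M l (take (leaves l) xs))
       (\<lambda>a. Option.bind (bracket_mul M r (drop (leaves l) xs)) (\<lambda>b. pmul M a b))"

definition multiplicable :: "'a pmagma \<Rightarrow> 'a list \<Rightarrow> bool" where
  "multiplicable M xs \<longleftrightarrow> (\<forall>T. leaves T = length xs \<longrightarrow> bracket_mul M T xs \<noteq> None)"

definition partial_monoid :: "'a pmagma \<Rightarrow> bool" where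
  "partial_monoid M \<longleftrightarrow>
     partial_unital_magma M \<and>
     (\<forall>xs\<in>lists (elems M). length xs \<ge> 2 \<and> multiplicable M xs \<longrightarrow>
        (\<forall>T T'. leaves T = length xs \<and> leaves T' = length xs \<longrightarrow>
           bracket_mul M T xs = bracket_mul M T' xs)) \<and>
     (\<forall>xs\<in>lists (elems M). length xs \<ge> 2 \<and>
        (\<exists>T. leaves T = length xs \<and> bracket_mul M T xs \<noteq> None) \<longrightarrow> multiplicable M xs)"

text \<open>Morphisms are extensional functions on the carrier, so that equality of morphisms is
  equality of maps.\<close>

definition pm_hom :: "'a pmagma \<Rightarrow> 'b pmagma \<Rightarrow> ('a \<Rightarrow> 'b) set" where
  "pm_hom M N = {f \<in> elems M \<rightarrow>\<^sub>E elems N.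
     f (pone M) = pone N \<and>
     (\<forall>a b c. pmul M a b = Some c \<longrightarrow> pmul N (f a) (f b) = Some (f c))}"

definition pm_id :: "'a pmagma \<Rightarrow> 'a \<Rightarrow> 'a" where
  "pm_id M = (\<lambda>a\<in>elems M. a)"

definition pm_comp :: "'a pmagma \<Rightarrow> ('b \<Rightarrow> 'c) \<Rightarrow> ('a \<Rightarrow> 'b) \<Rightarrow> 'a \<Rightarrow> 'c" where
  "pm_comp M g f = compose (elems M) g f"


section \<open>Simplicial sets\<close>

text \<open>Monotone maps \<open>[n] \<rightarrow> [k]\<close>, where \<open>[n]\<close> is \<open>{..n}\<close>, again as extensional functions.\<close>

definition delta_hom :: "nat \<Rightarrow> nat \<Rightarrow> (nat \<Rightarrow> nat) set" where
  "delta_hom n k = {\<phi> \<in> {..n} \<rightarrow>\<^sub>E {..k}. mono_on {..n} \<phi>}"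

text \<open>The map \<open>[length vs - 1] \<rightarrow> [n]\<close> with the given list of values.\<close>

definition vertex_map :: "nat list \<Rightarrow> nat \<Rightarrow> nat" where
  "vertex_map vs = (\<lambda>m\<in>{..<length vs}. vs ! m)"

text \<open>\<open>act X n k \<phi>\<close> is the map \<open>X\<^sub>k \<rightarrow> X\<^sub>n\<close> induced by \<open>\<phi> : [n] \<rightarrow> [k]\<close>.\<close>

record 'x sset =
  simp :: "nat \<Rightarrow> 'x set"
  act :: "nat \<Rightarrow> nat \<Rightarrow> (nat \<Rightarrow> nat) \<Rightarrow> 'x \<Rightarrow> 'x"

definition simplicial_set :: "'x sset \<Rightarrow> bool" where
  "simplicial_set X \<longleftrightarrow>
     (\<forall>n k. \<forall>\<phi>\<in>delta_hom n k. act X n k \<phi> \<in> simp X k \<rightarrow> simp X n) \<and>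
     (\<forall>n. \<forall>x\<in>simp X n. act X n n (\<lambda>i\<in>{..n}. i) x = x) \<and>
     (\<forall>l n k. \<forall>\<phi>\<in>delta_hom l n. \<forall>\<psi>\<in>delta_hom n k. \<forall>x\<in>simp X k.
        act X l k (compose {..l} \<psi> \<phi>) x = act X l n \<phi> (act X n k \<psi> x))"

definition sset_hom :: "'x sset \<Rightarrow> 'y sset \<Rightarrow> (nat \<Rightarrow> 'x \<Rightarrow> 'y) set" where
  "sset_hom X Y = {f. (\<forall>n. f n \<in> simp X n \<rightarrow>\<^sub>E simp Y n) \<and>
     (\<forall>n k. \<forall>\<phi>\<in>delta_hom n k. \<forall>x\<in>simp X k. f n (act X n k \<phi> x) = act Y n k \<phi> (f k x))}"

definition sset_id :: "'x sset \<Rightarrow> nat \<Rightarrow> 'x \<Rightarrow> 'x" where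
  "sset_id X = (\<lambda>n. \<lambda>x\<in>simp X n. x)"

definition sset_comp ::
  "'x sset \<Rightarrow> (nat \<Rightarrow> 'y \<Rightarrow> 'z) \<Rightarrow> (nat \<Rightarrow> 'x \<Rightarrow> 'y) \<Rightarrow> nat \<Rightarrow> 'x \<Rightarrow> 'z" where
  "sset_comp X g f = (\<lambda>n. compose (simp X n) (g n) (f n))"

definition sset_iso :: "'x sset \<Rightarrow> 'y sset \<Rightarrow> bool" where
  "sset_iso X Y \<longleftrightarrow> (\<exists>f\<in>sset_hom X Y. \<exists>g\<in>sset_hom Y X.
     sset_comp X g f = sset_id X \<and> sset_comp Y f g = sset_id Y)"

definition std_simplex :: "nat \<Rightarrow> (nat \<Rightarrow> nat) sset" where
  "std_simplex n = \<lparr>simp = (\<lambda>m. delta_hom m n), act = (\<lambda>m k \<phi> \<sigma>. compose {..m} \<sigma> \<phi>)\<rparr>"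

text \<open>The simplicial subset generated by a set of simplices, each paired with its dimension.\<close>

definition generated_subset :: "'x sset \<Rightarrow> (nat \<times> 'x) set \<Rightarrow> 'x sset" where
  "generated_subset X S =
     \<lparr>simp = (\<lambda>m. {act X m k \<phi> s | k \<phi> s. (k, s) \<in> S \<and> \<phi> \<in> delta_hom m k}), act = act X\<rparr>"

definition reduced_sset :: "'x sset \<Rightarrow> bool" where
  "reduced_sset X \<longleftrightarrow> is_singleton (simp X 0)"

text \<open>Restriction to the spine; for a simplicial set the values automatically lie in the iterated
  fibre product over \<open>X\<^sub>0\<close>.\<close>

definition spine_map :: "'x sset \<Rightarrow> nat \<Rightarrow> 'x \<Rightarrow> nat \<Rightarrow> 'x" where
  "spine_map X n x = (\<lambda>i\<in>{..<n}. act X 1 n (vertex_map [i, Suc i]) x)"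

definition spiny :: "'x sset \<Rightarrow> bool" where
  "spiny X \<longleftrightarrow> (\<forall>n\<ge>2. inj_on (spine_map X n) (simp X n))"

text \<open>\<open>p 0, \<dots>, p n\<close> are the vertices, in counterclockwise order, of a convex \<open>(n+1)\<close>-gon in the
  plane: any three of them, taken in increasing order of their labels, form a nondegenerate,
  counterclockwise triangle.  (The imaginary part is the determinant of the two edge vectors
  at \<open>p i\<close>.)\<close>

definition convex_polygon :: "nat \<Rightarrow> (nat \<Rightarrow> complex) \<Rightarrow> bool" where
  "convex_polygon n p \<longleftrightarrow>
     (\<forall>i j k. i < j \<and> j < k \<and> k \<le> n \<longrightarrow> Im (cnj (p j - p i) * (p k - p i)) > 0)"

text \<open>A triangulation is represented by the set of its (closed, solid) triangles;
  \<^const>\<open>triangulation\<close> says that there are finitely many and that any two of them meet in a common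
  face.\<close>

definition polygon_triangulation ::
  "nat \<Rightarrow> (nat \<Rightarrow> complex) \<Rightarrow> complex set set \<Rightarrow> bool" where
  "polygon_triangulation n p \<T> \<longleftrightarrow>
     triangulation \<T> \<and>
     \<Union>\<T> = convex hull (p ` {..n}) \<and>
     (\<forall>T\<in>\<T>. \<exists>i j k. i < j \<and> j < k \<and> k \<le> n \<and> T = convex hull {p i, p j, p k})"

definition triangulation_sset ::
  "nat \<Rightarrow> (nat \<Rightarrow> complex) \<Rightarrow> complex set set \<Rightarrow> (nat \<Rightarrow> nat) sset" where
  "triangulation_sset n p \<T> =
     generated_subset (std_simplex n)
       {(2, vertex_map [i, j, k]) | i j k.
          i < j \<and> j < k \<and> k \<le> n \<and> convex hull {p i, p j, p k} \<in> \<T>}"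

text \<open>An \<open>n\<close>-simplex, viewed as a map from the standard simplex, restricted to a simplicial
  subset \<open>A\<close>.\<close>

definition restrict_simplex ::
  "'x sset \<Rightarrow> nat \<Rightarrow> (nat \<Rightarrow> nat) sset \<Rightarrow> 'x \<Rightarrow> nat \<Rightarrow> (nat \<Rightarrow> nat) \<Rightarrow> 'x" where
  "restrict_simplex X n A x = (\<lambda>m. \<lambda>\<phi>\<in>simp A m. act X m n \<phi> x)"

definition two_segal :: "'x sset \<Rightarrow> bool" where
  "two_segal X \<longleftrightarrow>
     (\<forall>n\<ge>3. \<forall>p \<T>. convex_polygon n p \<and> polygon_triangulation n p \<T> \<longrightarrow>
        bij_betw (restrict_simplex X n (triangulation_sset n p \<T>))
          (simp X n) (sset_hom (triangulation_sset n p \<T>) X))"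


section \<open>The nerve\<close>

datatype delem = DOne | DM nat nat

fun dmul :: "delem \<Rightarrow> delem \<Rightarrow> delem option" where
  "dmul DOne x = Some x"
| "dmul x DOne = Some x"
| "dmul (DM i j) (DM j' k) = (if j = j' then Some (DM i k) else None)"

definition delems :: "nat \<Rightarrow> delem set" where
  "delems n = insert DOne {DM i j | i j. i < j \<and> j \<le> n}"

definition DD :: "nat \<Rightarrow> delem pmagma" where
  "DD n = \<lparr>elems = delems n, pone = DOne,
           pmul = (\<lambda>x y. if x \<in> delems n \<and> y \<in> delems n then dmul x y else None)\<rparr>"

text \<open>\<open>\<phi> : [n] \<rightarrow> [k]\<close> induces \<open>DD n \<rightarrow> DD k\<close>, with the convention \<open>m\<^sub>i\<^sub>i = 1\<close>.\<close>

primrec dmap_fun :: "(nat \<Rightarrow> nat) \<Rightarrow> delem \<Rightarrow> delem" where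
  "dmap_fun \<phi> DOne = DOne"
| "dmap_fun \<phi> (DM i j) = (if \<phi> i = \<phi> j then DOne else DM (\<phi> i) (\<phi> j))"

definition DD_map :: "nat \<Rightarrow> (nat \<Rightarrow> nat) \<Rightarrow> delem \<Rightarrow> delem" where
  "DD_map n \<phi> = (\<lambda>x\<in>delems n. dmap_fun \<phi> x)"

definition nerve :: "'a pmagma \<Rightarrow> (delem \<Rightarrow> 'a) sset" where
  "nerve M = \<lparr>simp = (\<lambda>n. pm_hom (DD n) M),
              act = (\<lambda>n k \<phi> x. pm_comp (DD n) x (DD_map n \<phi>))\<rparr>"

definition nerve_map ::
  "'a pmagma \<Rightarrow> ('a \<Rightarrow> 'b) \<Rightarrow> nat \<Rightarrow> (delem \<Rightarrow> 'a) \<Rightarrow> (delem \<Rightarrow> 'b)" where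
  "nerve_map M f = (\<lambda>n. \<lambda>x\<in>simp (nerve M) n. pm_comp (DD n) f x)"

end

theory Submission
  imports Defs
begin

text \<open>An \<open>n\<close>-simplex of the nerve is a composable chain of \<open>n\<close> elements all of whose consecutive
  products are defined, so it is determined by its spine. Cutting a polygon along the triangle at the
  edge \<open>0n\<close> and recursing turns a triangulation into a bracketing of the spine; since one
  defined bracketing forces all the others to be defined and equal, data on a triangulation extends
  uniquely to a simplex.

  Conversely, the edges of a spiny reduced simplicial set carry a partial product whose graph is the
  set of 2-simplices. The two triangulations of the square give associativity, and the fan
  triangulations show that chains of composable edges fill to simplices. The combinatorial inputs
  about genuine plane triangulations are: inside every edge \<open>ab\<close> with \<open>b > a + 1\<close> there is a
  triangle \<open>acb\<close>, and fans are triangulations.\<close>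


text \<open>\<open>two_segal\<close> speaks of solid triangles in the plane, so labels have to be
  recovered from geometry; most of this is reduced to signs of determinants of three points. The two
  directions use triangulations very differently. For a nerve, an arbitrary triangulation of an
  arbitrary polygon must be handled, and \<open>polygon_triangulation_step\<close> turns it into a
  binary tree. For the converse only fans and one further square are instantiated, with points on a
  parabola.

  2-Segal data is a map out of a simplicial subset, and one simplex of that subset may be presented
  by several triangles. Spininess and reducedness remove this obstacle: a simplex is determined by
  its edges, so a map can be specified by edge labels. Dimensions below 3 lie outside the 2-Segal
  condition and are treated by hand.\<close>

section \<open>Triangulations of convex polygons\<close>

text \<open>Twice the signed area of the triangle with vertices \<open>x\<close>, \<open>y\<close>, \<open>z\<close>.\<close>

definition orient :: "complex \<Rightarrow> complex \<Rightarrow> complex \<Rightarrow> real" where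
  "orient x y z = Im (cnj (y - x) * (z - x))"

lemma orient_cyclic: "orient y z x = orient x y z"
  by (simp add: orient_def algebra_simps)

lemma orient_swap: "orient x z y = - orient x y z"
  by (simp add: orient_def algebra_simps)

lemma orient_eq_0 [simp]: "orient x x y = 0" "orient x y x = 0" "orient x y y = 0"
  by (simp_all add: orient_def algebra_simps)

text \<open>Signed area is affine, not linear, in its last argument, hence the condition on the
  weights. Two-point combinations are the case \<open>w = 0\<close>.\<close>

lemma orient_combination:
  assumes "u + v + w = 1"
  shows "orient a b (u *\<^sub>R x + v *\<^sub>R y + w *\<^sub>R z) = u * orient a b x + v * orient a b y + w * orient a b z"
proof -
  have u: "u = 1 - v - w" using assms by simp
  show ?thesis unfolding u by (simp add: orient_def algebra_simps)
qed

text \<open>Cramer's rule without division: the signed areas that \<open>x\<close> spans with the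
  three sides are its unnormalised barycentric coordinates.\<close>

lemma orient_barycentric:
  "orient a b c *\<^sub>R x = orient b c x *\<^sub>R a + orient c a x *\<^sub>R b + orient a b x *\<^sub>R c"
  by (rule complex_eqI) (simp_all add: orient_def algebra_simps)

lemma orient_sum: "orient b c x + orient c a x + orient a b x = orient a b c"
  by (simp add: orient_def algebra_simps)

lemma in_triangleI:
  assumes "orient a b c > 0" "orient a b x \<ge> 0" "orient b c x \<ge> 0" "orient c a x \<ge> 0"
  shows "x \<in> convex hull {a, b, c}"
proof -
  let ?D = "orient a b c"
  have "x = (1 / ?D) *\<^sub>R (?D *\<^sub>R x)" using assms(1) by simp
  also have "\<dots> = (orient b c x / ?D) *\<^sub>R a + (orient c a x / ?D) *\<^sub>R b + (orient a b x / ?D) *\<^sub>R c"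
    by (subst orient_barycentric) (simp add: scaleR_add_right)
  finally have x: "x = \<dots>" .
  have "orient b c x / ?D + orient c a x / ?D + orient a b x / ?D = 1"
    using assms(1) by (simp add: add_divide_distrib[symmetric] orient_sum)
  moreover have "orient b c x / ?D \<ge> 0" "orient c a x / ?D \<ge> 0" "orient a b x / ?D \<ge> 0"
    using assms by auto
  ultimately show ?thesis unfolding convex_hull_3 using x by blast
qed

lemma convex_orient_nonneg: "convex {z. orient a b z \<ge> 0}"
proof (rule convexI)
  fix x y and u v :: real
  assume "x \<in> {z. orient a b z \<ge> 0}" "y \<in> {z. orient a b z \<ge> 0}" "u \<ge> 0" "v \<ge> 0" "u + v = 1"
  then show "u *\<^sub>R x + v *\<^sub>R y \<in> {z. orient a b z \<ge> 0}"
    using orient_combination[of u v 0 a b x y 0] by simp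
qed

text \<open>A closed half-plane is convex, so the generators decide. Read contrapositively, a hull
  point strictly beyond a line forces a generator strictly beyond it.\<close>

lemma orient_hull_nonneg:
  assumes "x \<in> convex hull S" "\<And>v. v \<in> S \<Longrightarrow> orient a b v \<ge> 0"
  shows "orient a b x \<ge> 0"
  using hull_minimal[of S "{z. orient a b z \<ge> 0}" convex] assms convex_orient_nonneg by blast

lemma affine_independent_orient:
  assumes "orient a b c \<noteq> 0"
  shows "\<not> affine_dependent {a, b, c}" "card {a, b, c} = 3"
proof -
  have ne: "a \<noteq> b" "a \<noteq> c" "b \<noteq> c"
    using assms by auto
  then show "card {a, b, c} = 3" by simp
  have "\<not> collinear {a, b, c}"
  proof
    assume "collinear {a, b, c}"
    then obtain u where "\<forall>x\<in>{a, b, c}. \<forall>y\<in>{a, b, c}. \<exists>r. x - y = r *\<^sub>R u"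
      unfolding collinear_def by blast
    then obtain r s where "b - a = r *\<^sub>R u" "c - a = s *\<^sub>R u" by blast
    then have "orient a b c = 0" by (simp add: orient_def)
    with assms show False by simp
  qed
  then show "\<not> affine_dependent {a, b, c}"
    using ne by (simp add: collinear_3_eq_affine_dependent)
qed

section \<open>Vertices and triangles of a convex polygon\<close>

lemma convex_polygon_orient:
  "convex_polygon n p \<Longrightarrow> i < j \<Longrightarrow> j < k \<Longrightarrow> k \<le> n \<Longrightarrow> orient (p i) (p j) (p k) > 0"
  by (simp add: convex_polygon_def orient_def)

text \<open>The three labels cut the cyclic order into gaps (below \<open>i\<close> and above
  \<open>k\<close> is one gap). A vertex in a gap lies strictly beyond the side facing that gap,
  while the triangle lies on the inner side.\<close>

lemma convex_polygon_vertex_in_triangle: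
  assumes P: "convex_polygon n p" and "i < j" "j < k" "k \<le> n" "a \<le> n"
    and a: "p a \<in> convex hull {p i, p j, p k}"
  shows "a \<in> {i, j, k}"
proof (rule ccontr)
  note pos = convex_polygon_orient[OF P]
  assume "a \<notin> {i, j, k}"
  then consider "a < i" | "i < a" "a < j" | "j < a" "a < k" | "k < a" by force
  then show False
  proof cases
    case 1
    have "orient (p k) (p i) (p a) \<ge> 0"
      by (rule orient_hull_nonneg[OF a])
        (use pos[of i j k] orient_cyclic[of "p i" "p j" "p k"] assms in auto)
    with pos[of a i k] orient_swap[of "p a" "p i" "p k"] orient_cyclic[of "p k" "p i" "p a"] 1 assms
    show False by simp
  next
    case 2
    have "orient (p i) (p j) (p a) \<ge> 0"
      by (rule orient_hull_nonneg[OF a]) (use pos[of i j k] assms in auto)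
    with pos[of i a j] orient_swap[of "p i" "p a" "p j"] 2 assms show False by simp
  next
    case 3
    have "orient (p j) (p k) (p a) \<ge> 0"
      by (rule orient_hull_nonneg[OF a])
        (use pos[of i j k] orient_cyclic[of "p j" "p k" "p i"] assms in auto)
    with pos[of j a k] orient_swap[of "p j" "p a" "p k"] 3 assms show False by simp
  next
    case 4
    have "orient (p k) (p i) (p a) \<ge> 0"
      by (rule orient_hull_nonneg[OF a])
        (use pos[of i j k] orient_cyclic[of "p i" "p j" "p k"] assms in auto)
    with pos[of i k a] orient_swap[of "p i" "p k" "p a"] orient_cyclic[of "p i" "p a" "p k"]
      orient_cyclic[of "p k" "p i" "p a"] 4 assms
    show False by simp
  qed
qed

text \<open>Convexity speaks only of triples, so a third label is needed; this is where
  \<open>n \<ge> 2\<close> enters. Two equal vertices would make that triple degenerate.\<close>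

lemma convex_polygon_inj:
  assumes P: "convex_polygon n p" and "n \<ge> 2" "i < j" "j \<le> n"
  shows "p i \<noteq> p j"
proof
  assume eq: "p i = p j"
  obtain k where k: "k \<le> n" "k \<noteq> i" "k \<noteq> j"
  proof -
    consider "0 \<notin> {i, j}" | "1 \<notin> {i, j}" | "2 \<notin> {i, j}" by force
    then show ?thesis using that[of 0] that[of 1] that[of 2] \<open>n \<ge> 2\<close> by cases simp_all
  qed
  from k(2,3) consider "k < i" | "i < k" "k < j" | "j < k" by force
  then show False
    using convex_polygon_orient[OF P, of k i j] convex_polygon_orient[OF P, of i k j]
      convex_polygon_orient[OF P, of i j k] assms(3,4) eq k(1) by cases simp_all
qed

text \<open>A triangulation stores point sets; labels are recoverable because the only polygon
  vertices in a triangle are its own corners.\<close>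

lemma polygon_triangle_unique:
  assumes P: "convex_polygon n p" and ijk: "i < j" "j < k" "k \<le> n"
    and ijk': "i' < j'" "j' < k'" "k' \<le> n"
    and eq: "convex hull {p i, p j, p k} = convex hull {p i', p j', p k'}"
  shows "i = i' \<and> j = j' \<and> k = k'"
proof -
  have "p v \<in> convex hull {p i', p j', p k'}" if "v \<in> {i, j, k}" for v
    using that unfolding eq[symmetric] by (auto intro: hull_inc)
  then have "{i, j, k} \<subseteq> {i', j', k'}"
    using ijk convex_polygon_vertex_in_triangle[OF P ijk'] by (smt (verit) insertE less_imp_le less_trans order_trans singletonD subsetI)
  then show ?thesis using ijk ijk' by auto
qed

text \<open>That \<open>0\<close> and \<open>n\<close> span such an edge is not known in advance, so
  later statements carry \<open>a = 0 \<and> b = n\<close> as a separate alternative.\<close>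

definition triangulation_edge ::
  "nat \<Rightarrow> (nat \<Rightarrow> complex) \<Rightarrow> complex set set \<Rightarrow> nat \<Rightarrow> nat \<Rightarrow> bool" where
  "triangulation_edge n p \<T> a b \<longleftrightarrow> a < b \<and>
     (\<exists>i j k. i < j \<and> j < k \<and> k \<le> n \<and> convex hull {p i, p j, p k} \<in> \<T> \<and> {a, b} \<subseteq> {i, j, k})"

text \<open>A point close to the midpoint of the edge \<open>ab\<close>, displaced towards the vertex \<open>a + 1\<close>, lies in
  a triangle that also contains the midpoint; that triangle has \<open>ab\<close> as an edge because faces are
  extreme.\<close>

lemma polygon_triangulation_step:
  assumes P: "convex_polygon n p" and T: "polygon_triangulation n p \<T>"
    and ab: "Suc a < b" "b \<le> n" and edge: "(a = 0 \<and> b = n) \<or> triangulation_edge n p \<T> a b"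
  obtains c where "a < c" "c < b" "convex hull {p a, p c, p b} \<in> \<T>"
proof -
  note pos = convex_polygon_orient[OF P]
  have tri: "triangulation \<T>" and cover: "\<Union>\<T> = convex hull (p ` {..n})"
    and shape: "\<And>t. t \<in> \<T> \<Longrightarrow> \<exists>i j k. i < j \<and> j < k \<and> k \<le> n \<and> t = convex hull {p i, p j, p k}"
    using T by (auto simp: polygon_triangulation_def)
  have pab: "p a \<noteq> p b"
    using convex_polygon_inj[OF P, of a b] ab by simp
  define m where "m = midpoint (p a) (p b)"
  define d where "d = p (Suc a)"
  have m: "m = (1/2) *\<^sub>R p a + (1/2) *\<^sub>R p b"
    by (simp add: m_def midpoint_def scaleR_add_right)
  \<comment> \<open>Finiteness of the triangulation makes \<open>U\<close> closed. Hence near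
    \<open>m\<close> every triangle that is met contains \<open>m\<close> itself.\<close>
  define U where "U = \<Union>{t \<in> \<T>. m \<notin> t}"
  have "closed U"
    unfolding U_def
  proof (rule closed_Union)
    show "finite {t \<in> \<T>. m \<notin> t}" using tri by (simp add: triangulation_def)
    show "\<forall>t\<in>{t \<in> \<T>. m \<notin> t}. closed t"
    proof
      fix t assume "t \<in> {t \<in> \<T>. m \<notin> t}"
      then obtain i j k where "t = convex hull {p i, p j, p k}" using shape by blast
      then show "closed t" by (simp add: compact_imp_closed finite_imp_compact_convex_hull)
    qed
  qed
  moreover have "m \<in> - U" by (auto simp: U_def)
  ultimately obtain e where e: "e > 0" "ball m e \<subseteq> - U"
    by (metis open_Compl open_contains_ball)
  \<comment> \<open>The bound 1 keeps \<open>q\<close> on the segment from \<open>m\<close> to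
    \<open>d\<close>; the other bound puts \<open>q\<close> within distance \<open>e\<close> of
    \<open>m\<close>. Adding 1 avoids a zero denominator.\<close>
  define s where "s = min 1 (e / (2 * (norm (d - m) + 1)))"
  have s: "0 < s" "s \<le> 1" using e by (auto simp: s_def add_nonneg_pos)
  define q where "q = (1 - s) *\<^sub>R m + s *\<^sub>R d"
  have "dist m q = s * norm (d - m)"
  proof -
    have "q - m = s *\<^sub>R (d - m)" by (simp add: q_def algebra_simps)
    then show ?thesis using s by (metis abs_of_pos dist_commute dist_norm norm_scaleR)
  qed
  also have "\<dots> \<le> e / (2 * (norm (d - m) + 1)) * norm (d - m)"
    by (rule mult_right_mono) (auto simp: s_def)
  also have "\<dots> < e"
  proof -
    have "norm (d - m) / (2 * (norm (d - m) + 1)) < 1"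
      by (subst divide_less_eq_1_pos) (auto simp: add_nonneg_pos)
    then show ?thesis using mult_strict_left_mono[OF _ e(1)] by fastforce
  qed
  finally have "q \<notin> U" using e(2) by auto
  have hull: "p i \<in> convex hull (p ` {..n})" if "i \<le> n" for i
    using that by (auto intro: hull_inc)
  have "m \<in> convex hull (p ` {..n})"
    unfolding m using ab by (intro convexD[OF convex_convex_hull] hull) auto
  then have "q \<in> convex hull (p ` {..n})"
    unfolding q_def d_def using ab s by (intro convexD[OF convex_convex_hull] hull) auto
  then obtain t where t: "t \<in> \<T>" "q \<in> t" using cover by blast
  then have mt: "m \<in> t" using \<open>q \<notin> U\<close> by (auto simp: U_def)
  obtain i j k where ijk: "i < j" "j < k" "k \<le> n" and t_eq: "t = convex hull {p i, p j, p k}"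
    using shape[OF t(1)] by blast
  have orient_m: "orient (p a) (p b) m = 0"
    using orient_combination[of "1/2" "1/2" 0 "p a" "p b" "p a" "p b"] by (simp add: m)
  have "orient (p a) (p b) q = s * orient (p a) (p b) d"
    using orient_combination[of "1 - s" s 0 "p a" "p b" m d] orient_m by (simp add: q_def)
  moreover have "orient (p a) (p b) d < 0"
    using pos[of a "Suc a" b] orient_swap[of "p a" d "p b"] ab by (simp add: d_def)
  ultimately have "orient (p a) (p b) q < 0" using s(1) by (simp add: mult_pos_neg)
  \<comment> \<open>\<open>q\<close> is strictly on the side of vertex \<open>a + 1\<close>, hence
    so is some corner of \<open>t\<close>; it becomes the apex.\<close>
  then obtain c where c: "c \<in> {i, j, k}" "orient (p a) (p b) (p c) < 0"
    using orient_hull_nonneg[of q "{p i, p j, p k}" "p a" "p b"] t(2) unfolding t_eq by force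
  \<comment> \<open>For an edge of a triangle \<open>t'\<close>, the set
    \<open>t' \<inter> t\<close> is a face of \<open>t'\<close> through an interior point of the
    segment, so it contains both ends. For \<open>0\<close> and \<open>n\<close> the line of the
    edge supports the polygon, so the weights of \<open>m\<close> on all other vertices
    vanish.\<close>
  have "p a \<in> t \<and> p b \<in> t"
    using edge
  proof
    assume "triangulation_edge n p \<T> a b"
    then obtain i' j' k' where t': "convex hull {p i', p j', p k'} \<in> \<T>" "{a, b} \<subseteq> {i', j', k'}"
      unfolding triangulation_edge_def by blast
    define t' where "t' = convex hull {p i', p j', p k'}"
    have "p a \<in> t'" "p b \<in> t'" using t'(2) by (auto simp: t'_def intro: hull_inc)
    moreover have "m \<in> t'"
      unfolding m using calculation
      by (intro convexD[of t']) (auto simp: t'_def)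
    moreover have "t' \<inter> t face_of t'"
      using tri t(1) t'(1) by (auto simp: triangulation_def t'_def)
    moreover have "m \<in> open_segment (p a) (p b)" using pab by (simp add: m_def)
    ultimately show ?thesis using mt by (meson IntD2 IntI face_ofD)
  next
    assume 0: "a = 0 \<and> b = n"
    obtain u v w where uvw: "u \<ge> 0" "v \<ge> 0" "w \<ge> 0" "u + v + w = 1"
      "m = u *\<^sub>R p i + v *\<^sub>R p j + w *\<^sub>R p k"
      using mt unfolding t_eq convex_hull_3 by auto
    let ?o = "\<lambda>i. orient (p a) (p b) (p i)"
    have neg: "?o l < 0" if "0 < l" "l < n" for l
      using pos[of 0 l n] orient_swap[of "p 0" "p l" "p n"] 0 that by simp
    have np: "?o l \<le> 0" if "l \<le> n" for l
      using neg[of l] 0 that by (cases "l = 0 \<or> l = n") auto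
    have "u * ?o i + v * ?o j + w * ?o k = 0"
      using orient_combination[OF uvw(4), of "p a" "p b" "p i" "p j" "p k"] orient_m uvw(5) by simp
    moreover have "u * ?o i \<le> 0" "v * ?o j \<le> 0" "w * ?o k \<le> 0"
      using uvw np ijk by (auto intro!: mult_nonneg_nonpos)
    ultimately have z: "u * ?o i = 0" "v * ?o j = 0" "w * ?o k = 0" by linarith+
    \<comment> \<open>\<open>j\<close> lies strictly between \<open>i\<close> and \<open>k\<close>,
      so it is neither \<open>0\<close> nor \<open>n\<close>.\<close>
    then have v: "v = 0" using neg[of j] ijk by auto
    have mab: "m \<noteq> p a" "m \<noteq> p b" using pab by (auto simp: m_def)
    have "i = 0"
    proof (rule ccontr)
      assume "i \<noteq> 0"
      then have "u = 0" using z neg[of i] ijk by auto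
      then have w: "w = 1" "m = p k" using uvw v by auto
      then have "k \<noteq> n" using mab 0 by auto
      then show False using z(3) w neg[of k] ijk by auto
    qed
    moreover have "k = n"
    proof (rule ccontr)
      assume "k \<noteq> n"
      then have "w = 0" using z neg[of k] ijk by auto
      then have "u = 1" "m = p i" using uvw v by auto
      then show False using mab 0 \<open>i = 0\<close> by auto
    qed
    ultimately show ?thesis using 0 by (auto simp: t_eq intro: hull_inc)
  qed
  then have abi: "a \<in> {i, j, k}" "b \<in> {i, j, k}"
    using convex_polygon_vertex_in_triangle[OF P ijk] ab unfolding t_eq by auto
  have cn: "c \<le> n" "c \<noteq> a" "c \<noteq> b" using c ijk by auto
  \<comment> \<open>For a label outside the interval from \<open>a\<close> to \<open>b\<close>, the
    cyclic order would make the signed area positive.\<close>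
  have ac: "a < c"
  proof (rule ccontr)
    assume "\<not> a < c"
    then show False
      using pos[of c a b] c cn ab orient_cyclic[of "p a" "p b" "p c"] by auto
  qed
  have cb: "c < b"
  proof (rule ccontr)
    assume "\<not> c < b"
    then show False using pos[of a b c] c cn ab by auto
  qed
  have "{a, c, b} = {i, j, k}"
    by (rule card_subset_eq) (use abi c(1) ac cb ijk in simp_all)
  from arg_cong[OF this, of "image p"] have "{p a, p c, p b} = {p i, p j, p k}"
    by simp
  with that[OF ac cb] t(1) t_eq show ?thesis by simp
qed

section \<open>Fans: triangulating by the diagonals from vertex 0\<close>

definition fan :: "(nat \<Rightarrow> complex) \<Rightarrow> nat \<Rightarrow> complex set set" where
  "fan p n = (\<lambda>i. convex hull {p 0, p i, p (Suc i)}) ` {1..<n}"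

text \<open>A discrete intermediate value argument: seen from vertex \<open>0\<close>, the point
  \<open>x\<close> is weakly left of the ray to vertex \<open>1\<close> and weakly right of the ray
  to vertex \<open>n\<close>, so two consecutive rays enclose it.\<close>

lemma fan_cover:
  assumes P: "convex_polygon n p" and n: "n \<ge> 2"
  shows "\<Union>(fan p n) = convex hull (p ` {..n})"
proof
  have "convex hull {p 0, p i, p (Suc i)} \<subseteq> convex hull (p ` {..n})" if "i < n" for i
    using that by (intro hull_mono) auto
  then show "\<Union>(fan p n) \<subseteq> convex hull (p ` {..n})" by (fastforce simp: fan_def)
next
  note pos = convex_polygon_orient[OF P]
  show "convex hull (p ` {..n}) \<subseteq> \<Union>(fan p n)"
  proof
    fix x assume x: "x \<in> convex hull (p ` {..n})"
    define h where "h = (\<lambda>i. orient (p 0) (p i) x)"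
    \<comment> \<open>The hull lies on the inner side of every polygon side; this bounds the fan
      triangle opposite to vertex \<open>0\<close>.\<close>
    have side: "orient (p i) (p (Suc i)) x \<ge> 0" if "i < n" for i
    proof (rule orient_hull_nonneg[OF x])
      fix v assume "v \<in> p ` {..n}"
      then obtain l where l: "l \<le> n" "v = p l" by auto
      consider "l < i" | "l = i" | "l = Suc i" | "Suc i < l" by linarith
      then show "orient (p i) (p (Suc i)) v \<ge> 0"
        using pos[of l i "Suc i"] pos[of i "Suc i" l] l that orient_cyclic[of "p i" "p (Suc i)" "p l"]
        by cases auto
    qed
    have h1: "h 1 \<ge> 0" using side[of 0] n by (simp add: h_def)
    have "orient (p n) (p 0) x \<ge> 0"
    proof (rule orient_hull_nonneg[OF x])
      fix v assume "v \<in> p ` {..n}"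
      then obtain l where l: "l \<le> n" "v = p l" by auto
      then show "orient (p n) (p 0) v \<ge> 0"
        using pos[of 0 l n] orient_cyclic[of "p 0" "p l" "p n"] by (cases "l = 0 \<or> l = n") auto
    qed
    then have hn: "h n \<le> 0"
      using orient_swap[of "p 0" "p n" x] orient_cyclic[of "p 0" x "p n"] orient_cyclic[of "p n" "p 0" x]
      by (simp add: h_def)
    have "\<exists>i\<ge>1. i < n \<and> h i \<ge> 0 \<and> h (Suc i) \<le> 0"
    proof (rule ccontr)
      assume no: "\<not> ?thesis"
      have "h i > 0" if "2 \<le> i" "i \<le> n" for i
        using that
      proof (induction i rule: dec_induct)
        case base
        have "\<not> h (Suc 1) \<le> 0" using no h1 n by fastforce
        then show ?case by (simp add: numeral_2_eq_2)
      next
        case (step i)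
        then have "\<not> h (Suc i) \<le> 0" using no by fastforce
        then show ?case by simp
      qed
      then show False using hn n by force
    qed
    then obtain i where i: "i \<ge> 1" "i < n" "h i \<ge> 0" "h (Suc i) \<le> 0" by blast
    have "x \<in> convex hull {p 0, p i, p (Suc i)}"
    proof (rule in_triangleI)
      show "orient (p 0) (p i) (p (Suc i)) > 0" using pos[of 0 i "Suc i"] i by simp
      show "orient (p (Suc i)) (p 0) x \<ge> 0"
        using i(4) orient_swap[of "p 0" "p (Suc i)" x] orient_cyclic[of "p 0" x "p (Suc i)"]
          orient_cyclic[of "p (Suc i)" "p 0" x]
        by (simp add: h_def)
    qed (use i side in \<open>auto simp: h_def\<close>)
    then show "x \<in> \<Union>(fan p n)" using i by (auto simp: fan_def)
  qed
qed

text \<open>The line through vertices \<open>0\<close> and \<open>i + 1\<close> separates the two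
  triangles. The answer is written as a hull of common corners, the form in which it is recognised
  as a face.\<close>

lemma fan_triangle_Int:
  assumes P: "convex_polygon n p" and ij: "1 \<le> i" "i < j" "j < n"
  shows "convex hull {p 0, p i, p (Suc i)} \<inter> convex hull {p 0, p j, p (Suc j)}
    = convex hull ({p 0} \<union> (if j = Suc i then {p j} else {}))"
    (is "?A \<inter> ?B = ?C")
proof
  show "?C \<subseteq> ?A \<inter> ?B" by (auto split: if_splits intro: hull_inc elim!: hull_mono[THEN subsetD, rotated])
next
  note pos = convex_polygon_orient[OF P]
  show "?A \<inter> ?B \<subseteq> ?C"
  proof
    fix x assume x: "x \<in> ?A \<inter> ?B"
    let ?o = "\<lambda>z. orient (p 0) (p (Suc i)) z"
    obtain u v w where uvw: "u \<ge> 0" "v \<ge> 0" "w \<ge> 0" "u + v + w = 1"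
      "x = u *\<^sub>R p 0 + v *\<^sub>R p i + w *\<^sub>R p (Suc i)"
      using x unfolding convex_hull_3 by auto
    obtain u' v' w' where uvw': "u' \<ge> 0" "v' \<ge> 0" "w' \<ge> 0" "u' + v' + w' = 1"
      "x = u' *\<^sub>R p 0 + v' *\<^sub>R p j + w' *\<^sub>R p (Suc j)"
      using x unfolding convex_hull_3 by auto
    have oi: "?o (p i) < 0"
      using pos[of 0 i "Suc i"] orient_swap[of "p 0" "p i" "p (Suc i)"] ij by simp
    have oj: "?o (p (Suc j)) > 0" "?o (p j) \<ge> 0" "j \<noteq> Suc i \<Longrightarrow> ?o (p j) > 0"
      using pos[of 0 "Suc i" "Suc j"] pos[of 0 "Suc i" j] ij by (cases "j = Suc i"; auto)+
    have "?o x = v * ?o (p i)"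
      using orient_combination[OF uvw(4), of "p 0" "p (Suc i)" "p 0" "p i" "p (Suc i)"] uvw(5) by simp
    moreover have x': "?o x = v' * ?o (p j) + w' * ?o (p (Suc j))"
      using orient_combination[OF uvw'(4), of "p 0" "p (Suc i)" "p 0" "p j" "p (Suc j)"] uvw'(5) by simp
    moreover have "v * ?o (p i) \<le> 0" "v' * ?o (p j) \<ge> 0" "w' * ?o (p (Suc j)) \<ge> 0"
      using uvw uvw' oi oj by (auto intro: mult_nonneg_nonpos)
    \<comment> \<open>The same number is at most 0 by the first triangle and at least 0 by the
      second, so every term vanishes.\<close>
    ultimately have z: "v' * ?o (p j) = 0" "w' * ?o (p (Suc j)) = 0" by linarith+
    then have w': "w' = 0" using oj by auto
    show "x \<in> ?C"
    proof (cases "j = Suc i")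
      case True
      have "x \<in> convex hull {p 0, p j}"
        using uvw' w' unfolding convex_hull_2 by auto
      with True show ?thesis by (simp add: insert_commute)
    next
      case False
      then have "v' = 0" using z oj by auto
      with w' uvw' False show ?thesis by simp
    qed
  qed
qed

lemma fan_triangulation:
  assumes P: "convex_polygon n p" and n: "n \<ge> 2"
  shows "polygon_triangulation n p (fan p n)"
proof -
  note pos = convex_polygon_orient[OF P]
  define t where "t = (\<lambda>i. convex hull {p 0, p i, p (Suc i)})"
  have ind: "\<not> affine_dependent {p 0, p i, p (Suc i)}" "card {p 0, p i, p (Suc i)} = 3"
    if "1 \<le> i" "i < n" for i
    using affine_independent_orient[of "p 0" "p i" "p (Suc i)"] pos[of 0 i "Suc i"] that by auto
  \<comment> \<open>Affine independence makes the hull of any set of corners a face.\<close>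
  have face: "convex hull S face_of t i" if "1 \<le> i" "i < n" "S \<subseteq> {p 0, p i, p (Suc i)}" for i S
    using that ind(1)[OF that(1,2)] unfolding t_def by (subst face_of_convex_hull_affine_independent) auto
  have Int: "t i \<inter> t j face_of t i \<and> t i \<inter> t j face_of t j" if "1 \<le> i" "i < j" "j < n" for i j
    using fan_triangle_Int[OF P that] face[of i] face[of j] that by (auto simp: t_def)
  have "triangulation (fan p n)"
    unfolding triangulation_def
  proof (intro conjI ballI allI impI)
    show "finite (fan p n)" by (simp add: fan_def)
    fix T assume "T \<in> fan p n"
    then obtain i where "1 \<le> i" "i < n" "T = t i" by (auto simp: fan_def t_def)
    then have "2 simplex T" using ind[of i] by (auto simp: simplex_def t_def)
    then show "\<exists>k. k simplex T" ..
  next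
    fix T T' assume "T \<in> fan p n \<and> T' \<in> fan p n"
    then obtain i j where ij: "1 \<le> i" "i < n" "T = t i" "1 \<le> j" "j < n" "T' = t j"
      by (auto simp: fan_def t_def)
    consider "i < j" | "i = j" | "j < i" by linarith
    then show "T \<inter> T' face_of T"
    proof cases
      case 1 then show ?thesis using Int[of i j] ij by simp
    next
      case 2 then show ?thesis using ij by (simp add: t_def face_of_refl)
    next
      case 3 then show ?thesis using Int[of j i] ij by (simp add: Int_commute)
    qed
  qed
  moreover have "\<exists>i j k. i < j \<and> j < k \<and> k \<le> n \<and> T = convex hull {p i, p j, p k}"
    if "T \<in> fan p n" for T
  proof -
    from that obtain i where "1 \<le> i" "i < n" "T = convex hull {p 0, p i, p (Suc i)}"
      by (auto simp: fan_def)
    then have "0 < i \<and> i < Suc i \<and> Suc i \<le> n \<and> T = convex hull {p 0, p i, p (Suc i)}" by auto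
    then show ?thesis by blast
  qed
  ultimately show ?thesis
    using fan_cover[OF assms] by (auto simp: polygon_triangulation_def)
qed

text \<open>A strictly convex curve supplies a polygon for every \<open>n\<close>; the determinant
  of three of its points is the Vandermonde product.\<close>

definition parabola :: "nat \<Rightarrow> complex" where
  "parabola i = Complex (real i) (real i ^ 2)"

lemma convex_polygon_parabola: "convex_polygon n parabola"
  unfolding convex_polygon_def
proof (intro allI impI)
  fix i j k assume "i < j \<and> j < k \<and> k \<le> n"
  then have "(real j - real i) * (real k - real i) * (real k - real j) > 0" by simp
  also have "(real j - real i) * (real k - real i) * (real k - real j)
      = Im (cnj (parabola j - parabola i) * (parabola k - parabola i))"
    by (simp add: parabola_def algebra_simps power2_eq_square)
  finally show "Im (cnj (parabola j - parabola i) * (parabola k - parabola i)) > 0" .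
qed

lemma fan_triangle_iff:
  assumes P: "convex_polygon n p" and ijk: "i < j" "j < k" "k \<le> n"
  shows "convex hull {p i, p j, p k} \<in> fan p n \<longleftrightarrow> i = 0 \<and> k = Suc j"
proof
  assume "convex hull {p i, p j, p k} \<in> fan p n"
  then obtain l where l: "1 \<le> l" "l < n" "convex hull {p i, p j, p k} = convex hull {p 0, p l, p (Suc l)}"
    by (auto simp: fan_def)
  then show "i = 0 \<and> k = Suc j"
    using polygon_triangle_unique[OF P ijk, of 0 l "Suc l"] by auto
next
  assume "i = 0 \<and> k = Suc j"
  then show "convex hull {p i, p j, p k} \<in> fan p n" using ijk by (auto simp: fan_def)
qed

text \<open>The triangulation of a square by the diagonal from \<open>1\<close> to \<open>3\<close> is the fan of the rotated square.\<close>

lemma square_other_diagonal: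
  obtains p \<T> where "convex_polygon 3 p" "polygon_triangulation 3 p \<T>"
    "convex hull {p 0, p 1, p 3} \<in> \<T>" "convex hull {p 1, p 2, p 3} \<in> \<T>"
    "\<And>i j k. i < j \<Longrightarrow> j < k \<Longrightarrow> k \<le> 3 \<Longrightarrow> convex hull {p i, p j, p k} \<in> \<T> \<Longrightarrow>
      (i = 0 \<and> j = 1 \<and> k = 3) \<or> (i = 1 \<and> j = 2 \<and> k = 3)"
proof -
  \<comment> \<open>A cyclic, hence orientation-preserving, relabelling: vertices 1, 2, 3 are the
    parabola points 0, 1, 2 and vertex 0 is point 3. The fan triangles 012 and 023 become 123 and
    013.\<close>
  define r :: "nat \<Rightarrow> nat" where "r = (\<lambda>i. if i = 0 then 3 else i - 1)"
  define p where "p = (\<lambda>i. parabola (r i))"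
  have P: "convex_polygon 3 p"
    unfolding convex_polygon_def
  proof (intro allI impI)
    fix i j k :: nat assume ijk: "i < j \<and> j < k \<and> k \<le> 3"
    have "orient (p i) (p j) (p k) > 0"
    proof (cases "i = 0")
      case True
      then have "j - 1 < k - 1" "k - 1 < 3" using ijk by auto
      then show ?thesis
        using True ijk convex_polygon_orient[OF convex_polygon_parabola, of "j - 1" "k - 1" 3 3]
          orient_cyclic[of "p j" "p k" "p i"] orient_cyclic[of "p i" "p j" "p k"]
        by (auto simp: p_def r_def)
    next
      case False
      then show ?thesis
        using ijk convex_polygon_orient[OF convex_polygon_parabola, of "i - 1" "j - 1" "k - 1" 3]
        by (auto simp: p_def r_def)
    qed
    then show "Im (cnj (p j - p i) * (p k - p i)) > 0" by (simp add: orient_def)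
  qed
  let ?T = "fan parabola 3"
  have p: "p 0 = parabola 3" "p 1 = parabola 0" "p 2 = parabola 1" "p 3 = parabola 2"
    by (auto simp: p_def r_def)
  have set3: "{..3} = {0, 1, 2, 3 :: nat}" by auto
  have T_eq: "?T = {convex hull {p 1, p 2, p 3}, convex hull {p 0, p 1, p 3}}"
  proof -
    have "{1..<3} = {1, 2 :: nat}" by auto
    then show ?thesis
      unfolding fan_def p by (auto simp: numeral_2_eq_2[symmetric] numeral_3_eq_3[symmetric] insert_commute)
  qed
  have "polygon_triangulation 3 parabola ?T"
    by (rule fan_triangulation[OF convex_polygon_parabola]) simp
  moreover have "p ` {..3} = parabola ` {..3}"
    unfolding set3 by (simp only: image_insert image_empty p) blast
  moreover have "\<exists>i j k. i < j \<and> j < k \<and> k \<le> 3 \<and> T = convex hull {p i, p j, p k}" if "T \<in> ?T" for T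
  proof -
    from that consider "T = convex hull {p 1, p 2, p 3}" | "T = convex hull {p 0, p 1, p 3}"
      unfolding T_eq by blast
    then show ?thesis
    proof cases
      case 1
      then have "1 < (2::nat) \<and> 2 < (3::nat) \<and> 3 \<le> (3::nat) \<and> T = convex hull {p 1, p 2, p 3}" by simp
      then show ?thesis by blast
    next
      case 2
      then have "0 < (1::nat) \<and> 1 < (3::nat) \<and> 3 \<le> (3::nat) \<and> T = convex hull {p 0, p 1, p 3}" by simp
      then show ?thesis by blast
    qed
  qed
  ultimately have T: "polygon_triangulation 3 p ?T"
    by (simp add: polygon_triangulation_def)
  show ?thesis
  proof (rule that[OF P T])
    fix i j k :: nat assume ijk: "i < j" "j < k" "k \<le> 3" and "convex hull {p i, p j, p k} \<in> ?T"
    then consider "convex hull {p i, p j, p k} = convex hull {p 1, p 2, p 3}"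
      | "convex hull {p i, p j, p k} = convex hull {p 0, p 1, p 3}"
      unfolding T_eq by blast
    then show "(i = 0 \<and> j = 1 \<and> k = 3) \<or> (i = 1 \<and> j = 2 \<and> k = 3)"
      using polygon_triangle_unique[OF P ijk, of 1 2 3] polygon_triangle_unique[OF P ijk, of 0 1 3]
      by cases auto
  qed (auto simp: T_eq)
qed


section \<open>Partial monoids\<close>

text \<open>Undefinedness is absorbing, so an equation between options says that both sides are
  defined together and then agree.\<close>

definition omul :: "'a pmagma \<Rightarrow> 'a option \<Rightarrow> 'a option \<Rightarrow> 'a option" where
  "omul M x y = Option.bind x (\<lambda>a. Option.bind y (pmul M a))"

lemma omul_simps [simp]:
  "omul M None y = None" "omul M x None = None" "omul M (Some a) (Some b) = pmul M a b"
  by (auto simp: omul_def split: Option.bind_split)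

definition pm_assoc :: "'a pmagma \<Rightarrow> bool" where
  "pm_assoc M \<longleftrightarrow> (\<forall>a b c. omul M (pmul M a b) (Some c) = omul M (Some a) (pmul M b c))"

lemma omul_assoc:
  assumes "pm_assoc M"
  shows "omul M (omul M x y) z = omul M x (omul M y z)"
  using assms by (cases x; cases y; cases z) (auto simp: pm_assoc_def)

text \<open>The right-nested bracketing, closed off by a unit so that empty words are allowed. All
  bracketings are compared with it.\<close>

primrec word_prod :: "'a pmagma \<Rightarrow> 'a list \<Rightarrow> 'a option" where
  "word_prod M [] = Some (pone M)"
| "word_prod M (x # xs) = omul M (Some x) (word_prod M xs)"

lemma pmul_elems:
  assumes "partial_unital_magma M" "pmul M a b = Some c"
  shows "a \<in> elems M" "b \<in> elems M" "c \<in> elems M"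
  using assms unfolding partial_unital_magma_def by blast+

lemma pone_elems: "partial_unital_magma M \<Longrightarrow> pone M \<in> elems M"
  by (simp add: partial_unital_magma_def)

lemma pmul_pone:
  assumes "partial_unital_magma M" "a \<in> elems M"
  shows "pmul M a (pone M) = Some a" "pmul M (pone M) a = Some a"
  using assms by (auto simp: partial_unital_magma_def)

lemma word_prod_elems:
  assumes "partial_unital_magma M" "word_prod M xs = Some a"
  shows "a \<in> elems M"
  using assms
  by (cases xs) (auto simp: pone_elems omul_def Option.bind_eq_Some_conv dest: pmul_elems)

text \<open>The letters need not be assumed in the carrier: a defined word product lies there, which
  is what the unit law asks for in the \<open>Nil\<close> case.\<close>

lemma word_prod_append:
  assumes "partial_unital_magma M" "pm_assoc M"
  shows "word_prod M (xs @ ys) = omul M (word_prod M xs) (word_prod M ys)"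
proof (induction xs)
  case Nil
  then show ?case
    using word_prod_elems[OF assms(1)]
    by (cases "word_prod M ys") (auto simp: pmul_pone[OF assms(1)])
next
  case (Cons x xs)
  then show ?case
    by (simp add: omul_assoc[OF assms(2)])
qed

text \<open>Contains both n-ary axioms at once, since a single option serves for all trees. Letters
  must lie in the carrier because a leaf is compared with its product by the unit.\<close>

lemma bracket_mul_eq_word_prod:
  assumes "partial_unital_magma M" "pm_assoc M"
  shows "xs \<in> lists (elems M) \<Longrightarrow> leaves T = length xs \<Longrightarrow> bracket_mul M T xs = word_prod M xs"
proof (induction T arbitrary: xs)
  case Leaf
  then obtain x where "xs = [x]" by (cases xs) auto
  with Leaf show ?case by (simp add: pmul_pone[OF assms(1)])
next
  case (Node l r)
  have l: "bracket_mul M l (take (leaves l) xs) = word_prod M (take (leaves l) xs)"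
    using Node.prems by (intro Node.IH) (auto dest: in_set_takeD)
  have r: "bracket_mul M r (drop (leaves l) xs) = word_prod M (drop (leaves l) xs)"
    using Node.prems by (intro Node.IH) (auto dest: in_set_dropD)
  have "bracket_mul M (Node l r) xs
      = omul M (word_prod M (take (leaves l) xs)) (word_prod M (drop (leaves l) xs))"
    by (simp add: l r omul_def)
  also have "\<dots> = word_prod M (take (leaves l) xs @ drop (leaves l) xs)"
    by (rule word_prod_append[OF assms, symmetric])
  finally show ?case by simp
qed

text \<open>The two trees with three leaves turn the n-ary axioms into the ternary law. If the
  triple is not multiplicable, neither tree is defined on it; outside the carrier both sides are
  undefined anyway.\<close>

lemma partial_monoid_assoc:
  assumes "partial_monoid M"
  shows "pm_assoc M"
  unfolding pm_assoc_def
proof (intro allI)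
  fix a b c
  have pum: "partial_unital_magma M"
    using assms by (simp add: partial_monoid_def)
  show "omul M (pmul M a b) (Some c) = omul M (Some a) (pmul M b c)"
  proof (cases "a \<in> elems M \<and> b \<in> elems M \<and> c \<in> elems M")
    case True
    define T where "T = Node (Node Leaf Leaf) Leaf"
    define T' where "T' = Node Leaf (Node Leaf Leaf)"
    have xs: "[a, b, c] \<in> lists (elems M)" "length [a, b, c] \<ge> 2"
      "leaves T = length [a, b, c]" "leaves T' = length [a, b, c]"
      using True by (auto simp: T_def T'_def)
    have T: "bracket_mul M T [a, b, c] = omul M (pmul M a b) (Some c)"
      by (simp add: T_def omul_def)
    have T': "bracket_mul M T' [a, b, c] = omul M (Some a) (pmul M b c)"
      by (simp add: T'_def omul_def)
    have "bracket_mul M T [a, b, c] = bracket_mul M T' [a, b, c]"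
    proof (cases "multiplicable M [a, b, c]")
      case True
      then show ?thesis
        using assms xs unfolding partial_monoid_def by blast
    next
      case False
      then have "bracket_mul M T [a, b, c] = None" "bracket_mul M T' [a, b, c] = None"
        using assms xs unfolding partial_monoid_def by blast+
      then show ?thesis by simp
    qed
    then show ?thesis by (simp only: T T')
  next
    case False
    have "omul M (pmul M a b) (Some c) = None"
      using False
      by (intro ccontr[of "_ = None"]) (auto simp: omul_def Option.bind_eq_Some_conv dest: pmul_elems[OF pum])
    moreover have "omul M (Some a) (pmul M b c) = None"
      using False
      by (intro ccontr[of "_ = None"]) (auto simp: omul_def Option.bind_eq_Some_conv dest: pmul_elems[OF pum])
    ultimately show ?thesis by simp
  qed
qed

lemma partial_monoidI:
  assumes "partial_unital_magma M" "pm_assoc M"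
  shows "partial_monoid M"
  using assms bracket_mul_eq_word_prod[OF assms]
  unfolding partial_monoid_def multiplicable_def by metis


section \<open>Monotone maps and simplicial sets\<close>

lemma delta_hom_le: "\<phi> \<in> delta_hom n k \<Longrightarrow> i \<le> n \<Longrightarrow> \<phi> i \<le> k"
  by (auto simp: delta_hom_def PiE_iff)

lemma delta_hom_mono: "\<phi> \<in> delta_hom n k \<Longrightarrow> i \<le> j \<Longrightarrow> j \<le> n \<Longrightarrow> \<phi> i \<le> \<phi> j"
  by (auto simp: delta_hom_def mono_on_def)

lemma delta_homI:
  assumes "\<phi> \<in> extensional {..n}" "\<And>i. i \<le> n \<Longrightarrow> \<phi> i \<le> k"
    "\<And>i j. i \<le> j \<Longrightarrow> j \<le> n \<Longrightarrow> \<phi> i \<le> \<phi> j"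
  shows "\<phi> \<in> delta_hom n k"
  using assms by (auto simp: delta_hom_def PiE_iff mono_on_def)

lemma delta_hom_compose:
  assumes "\<phi> \<in> delta_hom l n" "\<psi> \<in> delta_hom n k"
  shows "compose {..l} \<psi> \<phi> \<in> delta_hom l k"
  by (rule delta_homI)
    (auto simp: compose_def intro!: delta_hom_le[OF assms(2)] delta_hom_mono[OF assms(2)]
       delta_hom_le[OF assms(1)] delta_hom_mono[OF assms(1)])

lemma compose_delta_assoc:
  assumes "\<phi> \<in> delta_hom l n"
  shows "compose {..l} (compose {..n} \<psi> \<theta>) \<phi> = compose {..l} \<psi> (compose {..l} \<theta> \<phi>)"
  by (rule ext) (auto simp: compose_def delta_hom_le[OF assms])

lemma vertex_map_single_apply: "vertex_map [i] m = (if m = 0 then i else undefined)"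
  by (simp add: vertex_map_def)

lemma vertex_map_pair_apply: "vertex_map [i, j] m = (if m = 0 then i else if m = 1 then j else undefined)"
  by (auto simp: vertex_map_def less_Suc_eq)

lemma vertex_map_triple_apply:
  "vertex_map [i, j, k] m
    = (if m = 0 then i else if m = 1 then j else if m = 2 then k else undefined)"
  by (auto simp: vertex_map_def less_Suc_eq numeral_2_eq_2)

lemma vertex_map_pair_hom: "i \<le> j \<Longrightarrow> j \<le> n \<Longrightarrow> vertex_map [i, j] \<in> delta_hom 1 n"
  by (rule delta_homI) (auto simp: vertex_map_pair_apply extensional_def le_Suc_eq)

lemma vertex_map_triple_hom:
  "i \<le> j \<Longrightarrow> j \<le> k \<Longrightarrow> k \<le> n \<Longrightarrow> vertex_map [i, j, k] \<in> delta_hom 2 n"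
  by (rule delta_homI) (auto simp: vertex_map_triple_apply extensional_def le_Suc_eq numeral_2_eq_2)

lemma compose_vertex_map_pair: "compose {..1} \<phi> (vertex_map [i, j]) = vertex_map [\<phi> i, \<phi> j]"
  by (rule ext) (auto simp: compose_def vertex_map_pair_apply le_Suc_eq)

lemma vertex_map_01: "vertex_map [0, 1] = (\<lambda>i\<in>{..1}. i)"
  by (rule ext) (auto simp: vertex_map_pair_apply le_Suc_eq)

lemma act_closed:
  "simplicial_set X \<Longrightarrow> \<phi> \<in> delta_hom n k \<Longrightarrow> x \<in> simp X k \<Longrightarrow> act X n k \<phi> x \<in> simp X n"
  unfolding simplicial_set_def by blast

lemma act_id: "simplicial_set X \<Longrightarrow> x \<in> simp X n \<Longrightarrow> act X n n (\<lambda>i\<in>{..n}. i) x = x"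
  unfolding simplicial_set_def by blast

lemma act_comp:
  "simplicial_set X \<Longrightarrow> \<phi> \<in> delta_hom l n \<Longrightarrow> \<psi> \<in> delta_hom n k \<Longrightarrow> x \<in> simp X k \<Longrightarrow>
    act X l n \<phi> (act X n k \<psi> x) = act X l k (compose {..l} \<psi> \<phi>) x"
  unfolding simplicial_set_def by metis

lemma sset_hom_closed: "f \<in> sset_hom X Y \<Longrightarrow> x \<in> simp X n \<Longrightarrow> f n x \<in> simp Y n"
  unfolding sset_hom_def by blast

lemma sset_hom_act:
  "f \<in> sset_hom X Y \<Longrightarrow> \<phi> \<in> delta_hom n k \<Longrightarrow> x \<in> simp X k \<Longrightarrow>
    f n (act X n k \<phi> x) = act Y n k \<phi> (f k x)"
  unfolding sset_hom_def by blast

lemma sset_hom_eqI: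
  assumes "f \<in> sset_hom X Y" "g \<in> sset_hom X Y" "\<And>n x. x \<in> simp X n \<Longrightarrow> f n x = g n x"
  shows "f = g"
proof (intro ext)
  fix n x
  have "f n \<in> extensional (simp X n)" "g n \<in> extensional (simp X n)"
    using assms(1,2) by (auto simp: sset_hom_def PiE_iff)
  with assms(3) show "f n x = g n x"
    by (cases "x \<in> simp X n") (auto simp: extensional_def)
qed

lemma sset_homI:
  assumes "\<And>n x. x \<in> simp X n \<Longrightarrow> f n x \<in> simp Y n" "\<And>n. f n \<in> extensional (simp X n)"
    "\<And>n k \<phi> x. \<phi> \<in> delta_hom n k \<Longrightarrow> x \<in> simp X k \<Longrightarrow> f n (act X n k \<phi> x) = act Y n k \<phi> (f k x)"
  shows "f \<in> sset_hom X Y"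
  using assms by (auto simp: sset_hom_def PiE_iff)

text \<open>Closure under the action is assumed directly because the lemma is applied to
  \<open>triangulation_sset\<close>, for which only this closure is established.\<close>

lemma sset_comp_hom:
  assumes "f \<in> sset_hom X Y" "g \<in> sset_hom Y Z"
    and "\<And>n k \<phi> x. \<phi> \<in> delta_hom n k \<Longrightarrow> x \<in> simp X k \<Longrightarrow> act X n k \<phi> x \<in> simp X n"
  shows "sset_comp X g f \<in> sset_hom X Z"
  by (rule sset_homI)
    (auto simp: sset_comp_def compose_def sset_hom_act[OF assms(1)] assms(3)
        sset_hom_act[OF assms(2)] sset_hom_closed[OF assms(1)] sset_hom_closed[OF assms(2)])

lemma sset_iso_sym: "sset_iso X Y \<Longrightarrow> sset_iso Y X"
  unfolding sset_iso_def by blast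

text \<open>The levelwise inverse is automatically simplicial: apply \<open>f\<close> to both sides
  and cancel.\<close>

lemma sset_isoI:
  assumes X: "\<And>n k \<phi> x. \<phi> \<in> delta_hom n k \<Longrightarrow> x \<in> simp X k \<Longrightarrow> act X n k \<phi> x \<in> simp X n"
    and f: "f \<in> sset_hom X Y" and bij: "\<And>n. bij_betw (f n) (simp X n) (simp Y n)"
    and Y: "\<And>n k \<phi> x. \<phi> \<in> delta_hom n k \<Longrightarrow> x \<in> simp Y k \<Longrightarrow> act Y n k \<phi> x \<in> simp Y n"
  shows "sset_iso X Y"
proof -
  define g where "g = (\<lambda>n. \<lambda>y\<in>simp Y n. inv_into (simp X n) (f n) y)"
  have g1: "g n (f n x) = x" if "x \<in> simp X n" for n x
    using that bij[of n] sset_hom_closed[OF f that] by (simp add: g_def bij_betw_def)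
  have g2: "f n (g n y) = y" "g n y \<in> simp X n" if "y \<in> simp Y n" for n y
    using that bij[of n] by (auto simp: g_def bij_betw_def f_inv_into_f intro: inv_into_into)
  have "g \<in> sset_hom Y X"
  proof (rule sset_homI)
    fix n k \<phi> y assume *: "\<phi> \<in> delta_hom n k" "y \<in> simp Y k"
    have "act Y n k \<phi> y = f n (act X n k \<phi> (g k y))"
      using * g2 by (simp add: sset_hom_act[OF f])
    then show "g n (act Y n k \<phi> y) = act X n k \<phi> (g k y)"
      using * g1 g2 X by simp
  qed (use g2 in \<open>auto simp: g_def\<close>)
  moreover have "sset_comp X g f = sset_id X" "sset_comp Y f g = sset_id Y"
    by (auto simp: sset_comp_def sset_id_def compose_def g1 g2 fun_eq_iff)
  ultimately show ?thesis
    using f unfolding sset_iso_def by blast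
qed

lemma sset_isoE:
  assumes "sset_iso X Y"
  obtains f g where "f \<in> sset_hom X Y" "g \<in> sset_hom Y X"
    "\<And>n x. x \<in> simp X n \<Longrightarrow> g n (f n x) = x" "\<And>n y. y \<in> simp Y n \<Longrightarrow> f n (g n y) = y"
proof -
  obtain f g where fg: "f \<in> sset_hom X Y" "g \<in> sset_hom Y X"
    and eq: "sset_comp X g f = sset_id X" "sset_comp Y f g = sset_id Y"
    using assms unfolding sset_iso_def by blast
  have "g n (f n x) = x" if "x \<in> simp X n" for n x
    using that fun_cong[OF fun_cong[OF eq(1)], of n x] by (simp add: sset_comp_def sset_id_def compose_def)
  moreover have "f n (g n y) = y" if "y \<in> simp Y n" for n y
    using that fun_cong[OF fun_cong[OF eq(2)], of n y] by (simp add: sset_comp_def sset_id_def compose_def)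
  ultimately show ?thesis using fg that by blast
qed


declare One_nat_def [simp del]

section \<open>The nerve is a simplicial set\<close>

text \<open>With equal indices read as the unit, products by the unit become chains with a repeated
  index, and monotone maps act without case distinctions.\<close>

definition dm :: "nat \<Rightarrow> nat \<Rightarrow> delem" where
  "dm i j = (if i = j then DOne else DM i j)"

lemma dm_same [simp]: "dm i i = DOne"
  by (simp add: dm_def)

lemma DD_simps [simp]: "elems (DD n) = delems n" "pone (DD n) = DOne"
  by (auto simp: DD_def)

lemma dm_delems: "i \<le> j \<Longrightarrow> j \<le> n \<Longrightarrow> dm i j \<in> delems n"
  by (auto simp: dm_def delems_def)

lemma delemsE:
  assumes "d \<in> delems n"
  obtains i j where "i \<le> j" "j \<le> n" "d = dm i j"
proof (cases d)
  case DOne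
  then show ?thesis using that[of 0 0] by simp
next
  case (DM i j)
  then show ?thesis using assms that[of i j] by (auto simp: delems_def dm_def)
qed

lemma dmap_fun_dm: "dmap_fun \<phi> (dm i j) = dm (\<phi> i) (\<phi> j)"
  by (auto simp: dm_def)

lemma pmul_DD_dm:
  "i \<le> j \<Longrightarrow> j \<le> k \<Longrightarrow> k \<le> n \<Longrightarrow> pmul (DD n) (dm i j) (dm j k) = Some (dm i k)"
  using dm_delems[of i j n] dm_delems[of j k n] by (auto simp: DD_def dm_def)

text \<open>Every product, unit factors included, is a weak chain: a unit is read as
  \<open>dm\<close> at the adjoining index of the other factor.\<close>

lemma pmul_DD_eq_SomeE:
  assumes "pmul (DD n) a b = Some c"
  obtains i j k where "i \<le> j" "j \<le> k" "k \<le> n" "a = dm i j" "b = dm j k" "c = dm i k"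
proof -
  have ab: "a \<in> delems n" "b \<in> delems n" and d: "dmul a b = Some c"
    using assms by (auto simp: DD_def split: if_splits)
  obtain i j where ij: "i \<le> j" "j \<le> n" "a = dm i j" using ab(1) by (rule delemsE)
  obtain j' k where jk: "j' \<le> k" "k \<le> n" "b = dm j' k" using ab(2) by (rule delemsE)
  consider "i = j" | "i \<noteq> j" "j' = k" | "i \<noteq> j" "j' \<noteq> k" by blast
  then show ?thesis
  proof cases
    case 1 then show ?thesis using that[of j' j' k] ij jk d by simp
  next
    case 2 then show ?thesis using that[of i j j] ij jk d by (simp add: dm_def)
  next
    case 3
    then have "j' = j" "c = dm i k" using ij jk d by (auto simp: dm_def split: if_splits)
    then show ?thesis using that[of i j k] ij jk by simp
  qed
qed

lemma DD_homI:
  assumes "x \<in> extensional (delems n)"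
    and "x DOne = pone M"
    and "\<And>i j. i \<le> j \<Longrightarrow> j \<le> n \<Longrightarrow> x (dm i j) \<in> elems M"
    and "\<And>i j k. i \<le> j \<Longrightarrow> j \<le> k \<Longrightarrow> k \<le> n \<Longrightarrow>
           pmul M (x (dm i j)) (x (dm j k)) = Some (x (dm i k))"
  shows "x \<in> pm_hom (DD n) M"
  using assms unfolding pm_hom_def
  by (auto simp: PiE_iff elim!: pmul_DD_eq_SomeE delemsE)

lemma pm_hom_elems: "x \<in> pm_hom A M \<Longrightarrow> a \<in> elems A \<Longrightarrow> x a \<in> elems M"
  unfolding pm_hom_def by blast

lemma pm_hom_pone: "x \<in> pm_hom A M \<Longrightarrow> x (pone A) = pone M"
  unfolding pm_hom_def by blast

lemma pm_hom_pmul: "x \<in> pm_hom A M \<Longrightarrow> pmul A a b = Some c \<Longrightarrow> pmul M (x a) (x b) = Some (x c)"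
  unfolding pm_hom_def by blast

lemma pm_hom_ext: "x \<in> pm_hom A M \<Longrightarrow> x \<in> extensional (elems A)"
  unfolding pm_hom_def by (simp add: PiE_iff)

lemma DD_hom_DOne: "x \<in> pm_hom (DD n) M \<Longrightarrow> x DOne = pone M"
  using pm_hom_pone by fastforce

lemma DD_hom_elems: "x \<in> pm_hom (DD n) M \<Longrightarrow> i \<le> j \<Longrightarrow> j \<le> n \<Longrightarrow> x (dm i j) \<in> elems M"
  by (rule pm_hom_elems) (auto intro: dm_delems)

lemma DD_hom_pmul:
  "x \<in> pm_hom (DD n) M \<Longrightarrow> i \<le> j \<Longrightarrow> j \<le> k \<Longrightarrow> k \<le> n \<Longrightarrow>
    pmul M (x (dm i j)) (x (dm j k)) = Some (x (dm i k))"
  by (erule pm_hom_pmul) (rule pmul_DD_dm)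

lemma DD_hom_eqI:
  assumes "x \<in> pm_hom (DD n) M" "y \<in> pm_hom (DD n) M"
    and "\<And>i j. i < j \<Longrightarrow> j \<le> n \<Longrightarrow> x (dm i j) = y (dm i j)"
  shows "x = y"
proof (rule extensionalityI[of _ "delems n"])
  fix d assume "d \<in> delems n"
  then obtain i j where "i \<le> j" "j \<le> n" "d = dm i j" by (rule delemsE)
  then show "x d = y d"
    using assms(3)[of i j] DD_hom_DOne[OF assms(1)] DD_hom_DOne[OF assms(2)]
    by (cases "i = j") auto
qed (use pm_hom_ext[OF assms(1)] pm_hom_ext[OF assms(2)] in auto)

text \<open>Induction on \<open>j - i\<close>, splitting off the last spine edge. This is the source
  of spininess of the nerve.\<close>

lemma DD_hom_eq_spineI:
  assumes x: "x \<in> pm_hom (DD n) M" and y: "y \<in> pm_hom (DD n) M"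
    and eq: "\<And>i. i < n \<Longrightarrow> x (dm i (Suc i)) = y (dm i (Suc i))"
  shows "x = y"
proof (rule DD_hom_eqI[OF x y])
  fix i j assume "i < j" "j \<le> n"
  then show "x (dm i j) = y (dm i j)"
  proof (induction "j - i" arbitrary: j)
    case (Suc d)
    then obtain k where k: "j = Suc k" by (cases j) auto
    show ?case
    proof (cases "i = k")
      case True
      then show ?thesis using eq[of i] k Suc by simp
    next
      case False
      then have "x (dm i k) = y (dm i k)"
        using Suc k by (intro Suc.hyps(1)) auto
      moreover have "x (dm k j) = y (dm k j)" using eq[of k] k Suc by simp
      ultimately show ?thesis
        using DD_hom_pmul[OF x, of i k j] DD_hom_pmul[OF y, of i k j] Suc k False by auto
    qed
  qed auto
qed

text \<open>The value at the unit is taken at index \<open>0\<close>, which exists for every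
  \<open>n\<close>; the lemmas below assume \<open>G\<close> constant on the diagonal.\<close>

definition DD_hom_of :: "nat \<Rightarrow> (nat \<Rightarrow> nat \<Rightarrow> 'a) \<Rightarrow> delem \<Rightarrow> 'a" where
  "DD_hom_of n G = (\<lambda>d\<in>delems n. case d of DOne \<Rightarrow> G 0 0 | DM i j \<Rightarrow> G i j)"

lemma DD_hom_of_dm:
  assumes "\<And>i. i \<le> n \<Longrightarrow> G i i = e" "i \<le> j" "j \<le> n"
  shows "DD_hom_of n G (dm i j) = G i j"
  using assms(1)[of 0] assms(1)[of i] assms(2,3) dm_delems[of i j n]
  by (cases "i = j") (auto simp: DD_hom_of_def dm_def)

text \<open>Chains with a repeated index follow from the unit laws, so only strict triples have to
  be supplied.\<close>

lemma DD_hom_of_hom: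
  assumes "partial_unital_magma M" "\<And>i. i \<le> n \<Longrightarrow> G i i = pone M"
    "\<And>i j. i < j \<Longrightarrow> j \<le> n \<Longrightarrow> G i j \<in> elems M"
    "\<And>i j k. i < j \<Longrightarrow> j < k \<Longrightarrow> k \<le> n \<Longrightarrow> pmul M (G i j) (G j k) = Some (G i k)"
  shows "DD_hom_of n G \<in> pm_hom (DD n) M"
proof (rule DD_homI)
  have el: "G i j \<in> elems M" if "i \<le> j" "j \<le> n" for i j
    using that assms(2)[of i] assms(3)[of i j] pone_elems[OF assms(1)] by (cases "i = j") auto
  show "DD_hom_of n G DOne = pone M"
    using DD_hom_of_dm[of n G "pone M" 0 0] assms(2) by simp
  show "DD_hom_of n G (dm i j) \<in> elems M" if "i \<le> j" "j \<le> n" for i j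
    using el[OF that] DD_hom_of_dm[of n G, OF assms(2) that] by simp
  fix i j k assume ijk: "i \<le> j" "j \<le> k" "k \<le> n"
  have "pmul M (G i j) (G j k) = Some (G i k)"
    using ijk el[of i j] el[of j k] assms(2)[of j] assms(4)[of i j k] pmul_pone[OF assms(1)]
    by (cases "i = j"; cases "j = k") auto
  then show "pmul M (DD_hom_of n G (dm i j)) (DD_hom_of n G (dm j k)) = Some (DD_hom_of n G (dm i k))"
    using ijk by (simp add: DD_hom_of_dm[of n G, OF assms(2)])
qed (auto simp: DD_hom_of_def)

lemma nerve_simp [simp]: "simp (nerve M) n = pm_hom (DD n) M"
  by (simp add: nerve_def)

lemma act_nerve_dm:
  assumes "\<phi> \<in> delta_hom n k" "i \<le> j" "j \<le> n"
  shows "act (nerve M) n k \<phi> x (dm i j) = x (dm (\<phi> i) (\<phi> j))"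
  using dm_delems[OF assms(2,3)]
  by (simp add: nerve_def pm_comp_def compose_def DD_map_def dmap_fun_dm)

lemma act_nerve_closed:
  assumes "\<phi> \<in> delta_hom n k" "x \<in> pm_hom (DD k) M"
  shows "act (nerve M) n k \<phi> x \<in> pm_hom (DD n) M"
proof (rule DD_homI)
  show "act (nerve M) n k \<phi> x DOne = pone M"
    using act_nerve_dm[OF assms(1), of 0 0 M x] DD_hom_DOne[OF assms(2)] by simp
  show "act (nerve M) n k \<phi> x \<in> extensional (delems n)"
    by (simp add: nerve_def pm_comp_def)
  fix i j l assume "i \<le> j" "j \<le> l" "l \<le> n"
  then show "pmul M (act (nerve M) n k \<phi> x (dm i j)) (act (nerve M) n k \<phi> x (dm j l))
      = Some (act (nerve M) n k \<phi> x (dm i l))"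
    using delta_hom_le[OF assms(1)] delta_hom_mono[OF assms(1)]
    by (simp add: act_nerve_dm[OF assms(1)] DD_hom_pmul[OF assms(2)])
qed (auto simp: act_nerve_dm[OF assms(1)] intro: DD_hom_elems[OF assms(2)]
    delta_hom_le[OF assms(1)] delta_hom_mono[OF assms(1)])

lemma simplicial_set_nerve: "simplicial_set (nerve M)"
  unfolding simplicial_set_def
proof (intro conjI allI ballI)
  fix n k \<phi> assume "\<phi> \<in> delta_hom n k"
  then show "act (nerve M) n k \<phi> \<in> simp (nerve M) k \<rightarrow> simp (nerve M) n"
    by (auto intro: act_nerve_closed)
next
  fix n x assume x: "x \<in> simp (nerve M) n"
  have "(\<lambda>i\<in>{..n}. i) \<in> delta_hom n n" by (rule delta_homI) auto
  then show "act (nerve M) n n (\<lambda>i\<in>{..n}. i) x = x"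
    using x by (intro DD_hom_eqI[of _ n M] act_nerve_closed) (auto simp: act_nerve_dm)
next
  fix l n k \<phi> \<psi> x
  assume *: "\<phi> \<in> delta_hom l n" "\<psi> \<in> delta_hom n k" "x \<in> simp (nerve M) k"
  note comp = delta_hom_compose[OF *(1,2)]
  show "act (nerve M) l k (compose {..l} \<psi> \<phi>) x = act (nerve M) l n \<phi> (act (nerve M) n k \<psi> x)"
    using * comp delta_hom_le[OF *(1)] delta_hom_mono[OF *(1)]
    by (intro DD_hom_eqI[of _ l M] act_nerve_closed) (auto simp: act_nerve_dm compose_def)
qed

lemma nerve_edge:
  assumes "i \<le> j" "j \<le> n"
  shows "act (nerve M) 1 n (vertex_map [i, j]) x (dm 0 1) = x (dm i j)"
  using act_nerve_dm[OF vertex_map_pair_hom[OF assms], of 0 1] by (simp add: vertex_map_pair_apply)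

lemma DD1_hom_eqI:
  assumes "x \<in> pm_hom (DD 1) M" "y \<in> pm_hom (DD 1) M" "x (dm 0 1) = y (dm 0 1)"
  shows "x = y"
proof (rule DD_hom_eqI[OF assms(1,2)])
  fix i j :: nat assume "i < j" "j \<le> 1"
  then have "i = 0" "j = 1" by auto
  with assms(3) show "x (dm i j) = y (dm i j)" by simp
qed


section \<open>The nerve functor is fully faithful\<close>

lemma pm_comp_dm:
  "i \<le> j \<Longrightarrow> j \<le> n \<Longrightarrow> pm_comp (DD n) f x (dm i j) = f (x (dm i j))"
  by (simp add: pm_comp_def compose_def dm_delems)

lemma pm_comp_hom:
  assumes "f \<in> pm_hom M N" "x \<in> pm_hom (DD n) M"
  shows "pm_comp (DD n) f x \<in> pm_hom (DD n) N"
proof (rule DD_homI)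
  show "pm_comp (DD n) f x DOne = pone N"
    using pm_comp_dm[of 0 0 n f x] DD_hom_DOne[OF assms(2)] pm_hom_pone[OF assms(1)] by simp
  show "pm_comp (DD n) f x \<in> extensional (delems n)"
    by (simp add: pm_comp_def)
qed (auto simp: pm_comp_dm intro: pm_hom_elems[OF assms(1)] DD_hom_elems[OF assms(2)]
    pm_hom_pmul[OF assms(1)] DD_hom_pmul[OF assms(2)])

lemma nerve_map_apply: "x \<in> pm_hom (DD n) M \<Longrightarrow> nerve_map M f n x = pm_comp (DD n) f x"
  by (simp add: nerve_map_def)

lemma nerve_map_hom:
  assumes "f \<in> pm_hom M N"
  shows "nerve_map M f \<in> sset_hom (nerve M) (nerve N)"
proof (rule sset_homI)
  fix n k \<phi> x assume *: "\<phi> \<in> delta_hom n k" "x \<in> simp (nerve M) k"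
  then show "nerve_map M f n (act (nerve M) n k \<phi> x) = act (nerve N) n k \<phi> (nerve_map M f k x)"
    using delta_hom_le[OF *(1)] delta_hom_mono[OF *(1)]
    by (intro DD_hom_eqI[of _ n N])
      (auto simp: nerve_map_apply act_nerve_closed pm_comp_dm act_nerve_dm
        intro!: pm_comp_hom[OF assms] act_nerve_closed)
next
  show "nerve_map M f n \<in> extensional (simp (nerve M) n)" for n
    by (simp add: nerve_map_def)
qed (auto simp: nerve_map_apply intro: pm_comp_hom[OF assms])

lemma nerve_map_id: "nerve_map M (pm_id M) = sset_id (nerve M)"
proof (rule ext, rule ext)
  fix n x
  show "nerve_map M (pm_id M) n x = sset_id (nerve M) n x"
  proof (cases "x \<in> pm_hom (DD n) M")
    case True
    then have "pm_comp (DD n) (pm_id M) x d = x d" for d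
      using pm_hom_elems[OF True, of d] pm_hom_ext[OF True]
      by (cases "d \<in> delems n") (auto simp: pm_comp_def compose_def pm_id_def extensional_def)
    with True show ?thesis by (auto simp: nerve_map_def sset_id_def)
  qed (simp add: nerve_map_def sset_id_def)
qed

lemma nerve_map_comp:
  assumes "f \<in> pm_hom M N"
  shows "nerve_map M (pm_comp M g f) = sset_comp (nerve M) (nerve_map N g) (nerve_map M f)"
proof (rule ext, rule ext)
  fix n x
  show "nerve_map M (pm_comp M g f) n x = sset_comp (nerve M) (nerve_map N g) (nerve_map M f) n x"
  proof (cases "x \<in> pm_hom (DD n) M")
    case True
    then have "pm_comp (DD n) (pm_comp M g f) x = pm_comp (DD n) g (pm_comp (DD n) f x)"
      using pm_hom_elems[OF True] by (auto simp: pm_comp_def compose_def fun_eq_iff)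
    with True pm_comp_hom[OF assms True] show ?thesis
      by (simp add: nerve_map_def sset_comp_def compose_def)
  qed (simp add: nerve_map_def sset_comp_def compose_def)
qed

text \<open>The inverse of evaluation at \<open>dm 0 1\<close>: one-simplices of the nerve are the
  elements of \<open>M\<close>.\<close>

definition arrow :: "'a pmagma \<Rightarrow> 'a \<Rightarrow> delem \<Rightarrow> 'a" where
  "arrow M a = DD_hom_of 1 (\<lambda>i j. if i = j then pone M else a)"

lemma arrow_hom:
  assumes "partial_unital_magma M" "a \<in> elems M"
  shows "arrow M a \<in> pm_hom (DD 1) M"
  unfolding arrow_def by (rule DD_hom_of_hom) (use assms in auto)

lemma arrow_apply: "arrow M a (dm 0 1) = a"
  using DD_hom_of_dm[of 1 "\<lambda>i j. if i = j then pone M else a" "pone M" 0 1] by (simp add: arrow_def)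

lemma arrow_unique: 
  assumes "partial_unital_magma M" "x \<in> pm_hom (DD 1) M"
  shows "arrow M (x (dm 0 1)) = x"
  using assms DD_hom_elems[OF assms(2), of 0 1] 
  by (intro DD1_hom_eqI[of _ M] arrow_hom) (auto simp: arrow_apply)

lemma nerve_map_inj:
  assumes "partial_unital_magma M"
  shows "inj_on (nerve_map M) (pm_hom M N)"
proof (rule inj_onI)
  fix f g assume fg: "f \<in> pm_hom M N" "g \<in> pm_hom M N" and eq: "nerve_map M f = nerve_map M g"
  have "f a = g a" if a: "a \<in> elems M" for a
  proof -
    have *: "nerve_map M h 1 (arrow M a) (dm 0 1) = h a" for h
      using pm_comp_dm[of 0 1 1 h "arrow M a"] arrow_apply[of M a]
      by (simp add: nerve_map_apply[OF arrow_hom[OF assms a]])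
    show ?thesis using *[of f] *[of g] eq by simp
  qed
  then show "f = g"
    using pm_hom_ext[OF fg(1)] pm_hom_ext[OF fg(2)] by (intro extensionalityI) auto
qed

text \<open>Naturality along the inclusion of the edge from \<open>i\<close> to \<open>j\<close>: a
  simplicial map between nerves is governed by its values in degree 1.\<close>

lemma nerve_hom_edge:
  assumes M: "partial_unital_magma M" and h: "h \<in> sset_hom (nerve M) (nerve N)"
    and x: "x \<in> pm_hom (DD n) M" and "i \<le> j" "j \<le> n"
  shows "h n x (dm i j) = h 1 (arrow M (x (dm i j))) (dm 0 1)"
proof -
  note v = vertex_map_pair_hom[OF assms(4,5)]
  have "h n x (dm i j) = act (nerve N) 1 n (vertex_map [i, j]) (h n x) (dm 0 1)"
    by (rule nerve_edge[OF assms(4,5), symmetric])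
  also have "\<dots> = h 1 (act (nerve M) 1 n (vertex_map [i, j]) x) (dm 0 1)"
    using sset_hom_act[OF h v] x by simp
  also have "act (nerve M) 1 n (vertex_map [i, j]) x = arrow M (x (dm i j))"
    using arrow_unique[OF M act_nerve_closed[OF v x]] nerve_edge[OF assms(4,5), of M x] by simp
  finally show ?thesis .
qed

lemma pmul_imp_DD2_hom:
  assumes M: "partial_unital_magma M" and c: "pmul M a b = Some c"
  obtains x where "x \<in> pm_hom (DD 2) M" "x (dm 0 1) = a" "x (dm 1 2) = b" "x (dm 0 2) = c"
proof -
  define G where "G = (\<lambda>i j :: nat. if i = j then pone M else if j = 1 then a else if i = 0 then c else b)"
  have "DD_hom_of 2 G \<in> pm_hom (DD 2) M"
  proof (rule DD_hom_of_hom[OF M])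
    fix i j k :: nat assume "i < j" "j < k" "k \<le> 2"
    then have "i = 0" "j = 1" "k = 2" by auto
    then show "pmul M (G i j) (G j k) = Some (G i k)" using c by (simp add: G_def)
  qed (use pmul_elems[OF M c] in \<open>auto simp: G_def\<close>)
  moreover have "DD_hom_of 2 G (dm i j) = G i j" if "i \<le> j" "j \<le> 2" for i j
    by (rule DD_hom_of_dm[OF _ that]) (simp add: G_def)
  from this[of 0 1] this[of 1 2] this[of 0 2]
  have "DD_hom_of 2 G (dm 0 1) = a" "DD_hom_of 2 G (dm 1 2) = b" "DD_hom_of 2 G (dm 0 2) = c"
    by (auto simp: G_def)
  ultimately show ?thesis using that by blast
qed

lemma nerve_map_surj:
  assumes M: "partial_unital_magma M" and h: "h \<in> sset_hom (nerve M) (nerve N)"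
  shows "\<exists>f\<in>pm_hom M N. nerve_map M f = h"
proof -
  define f where "f = (\<lambda>a\<in>elems M. h 1 (arrow M a) (dm 0 1))"
  have hn: "h n x \<in> pm_hom (DD n) N" if "x \<in> pm_hom (DD n) M" for n x
    using sset_hom_closed[OF h, of x n] that by simp
  have edge: "h n x (dm i j) = f (x (dm i j))" if "x \<in> pm_hom (DD n) M" "i \<le> j" "j \<le> n" for n x i j
    using nerve_hom_edge[OF M h that] DD_hom_elems[OF that] by (simp add: f_def)
  have f: "f \<in> pm_hom M N"
    unfolding pm_hom_def
  proof (intro CollectI conjI allI impI)
    have "f a \<in> elems N" if "a \<in> elems M" for a
      using DD_hom_elems[OF hn[OF arrow_hom[OF M that]], of 0 1] that by (simp add: f_def)
    then show "f \<in> elems M \<rightarrow>\<^sub>E elems N" by (auto simp: f_def)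
    \<comment> \<open>The unit is detected by a 0-simplex, whose only label is the unit both before
      and after applying \<open>h\<close>.\<close>
    let ?x = "DD_hom_of 0 (\<lambda>i j. pone M)"
    have x: "?x \<in> pm_hom (DD 0) M" by (rule DD_hom_of_hom[OF M]) auto
    show "f (pone M) = pone N"
      using edge[OF x, of 0 0] DD_hom_DOne[OF x] DD_hom_DOne[OF hn[OF x]] by simp
    fix a b c assume "pmul M a b = Some c"
    then obtain x where x: "x \<in> pm_hom (DD 2) M" "x (dm 0 1) = a" "x (dm 1 2) = b" "x (dm 0 2) = c"
      by (rule pmul_imp_DD2_hom[OF M])
    show "pmul N (f a) (f b) = Some (f c)"
      using DD_hom_pmul[OF hn[OF x(1)], of 0 1 2] edge[OF x(1), of 0 1] edge[OF x(1), of 1 2]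
        edge[OF x(1), of 0 2] x(2-) by simp
  qed
  moreover have "nerve_map M f = h"
  proof (rule sset_hom_eqI[OF nerve_map_hom[OF f] h])
    fix n x assume "x \<in> simp (nerve M) n"
    then have x: "x \<in> pm_hom (DD n) M" by simp
    show "nerve_map M f n x = h n x"
      by (rule DD_hom_eqI[of _ n N])
        (use x in \<open>auto simp: nerve_map_apply pm_comp_hom[OF f] hn edge pm_comp_dm\<close>)
  qed
  ultimately show ?thesis by blast
qed

lemma nerve_map_bij:
  assumes "partial_unital_magma M"
  shows "bij_betw (nerve_map M) (pm_hom M N) (sset_hom (nerve M) (nerve N))"
  unfolding bij_betw_def
  using nerve_map_inj[OF assms] nerve_map_hom nerve_map_surj[OF assms] by blast


section \<open>The nerve is spiny, reduced and 2-Segal\<close>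

lemma spiny_nerve: "spiny (nerve M)"
  unfolding spiny_def
proof (intro allI impI inj_onI)
  fix n x y
  assume x: "x \<in> simp (nerve M) n" and y: "y \<in> simp (nerve M) n"
    and eq: "spine_map (nerve M) n x = spine_map (nerve M) n y"
  show "x = y"
  proof (rule DD_hom_eq_spineI[of x n M y])
    fix i assume i: "i < n"
    have "act (nerve M) 1 n (vertex_map [i, Suc i]) x = act (nerve M) 1 n (vertex_map [i, Suc i]) y"
      using fun_cong[OF eq, of i] i by (simp add: spine_map_def)
    then show "x (dm i (Suc i)) = y (dm i (Suc i))"
      using nerve_edge[of i "Suc i" n M x] nerve_edge[of i "Suc i" n M y] i by simp
  qed (use x y in auto)
qed

lemma reduced_nerve:
  assumes "partial_unital_magma M"
  shows "reduced_sset (nerve M)"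
proof -
  have "DD_hom_of 0 (\<lambda>i j. pone M) \<in> pm_hom (DD 0) M"
    by (rule DD_hom_of_hom[OF assms]) auto
  moreover have "x = y" if "x \<in> pm_hom (DD 0) M" "y \<in> pm_hom (DD 0) M" for x y
    by (rule DD_hom_eqI[OF that]) auto
  ultimately have "simp (nerve M) 0 = {DD_hom_of 0 (\<lambda>i j. pone M)}" by auto
  then show ?thesis by (auto simp: reduced_sset_def is_singleton_def)
qed

section \<open>Recursion along a triangulation\<close>

lemma triangulation_edge_triple:
  assumes "i < j" "j < k" "k \<le> n" "convex hull {p i, p j, p k} \<in> \<T>"
  shows "triangulation_edge n p \<T> i j" "triangulation_edge n p \<T> j k" "triangulation_edge n p \<T> i k"
proof -
  have "i < k" using assms by simp
  then show "triangulation_edge n p \<T> i j" "triangulation_edge n p \<T> j k" "triangulation_edge n p \<T> i k"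
    unfolding triangulation_edge_def using assms by blast+
qed

lemma triangulation_edge_le: "triangulation_edge n p \<T> a b \<Longrightarrow> a < b \<and> b \<le> n"
  by (auto simp: triangulation_edge_def)

text \<open>Induction along the binary tree dual to the triangulation, rooted at the edge from
  \<open>0\<close> to \<open>n\<close>, with polygon sides as leaves. The measure is
  \<open>b - a\<close>; \<open>n \<ge> 2\<close> keeps the root from being a leaf.\<close>

lemma triangulation_edge_induct [consumes 4, case_names side split]:
  assumes P: "convex_polygon n p" and T: "polygon_triangulation n p \<T>" and n: "n \<ge> 2"
    and ab: "(a = 0 \<and> b = n) \<or> triangulation_edge n p \<T> a b"
    and side: "\<And>a. triangulation_edge n p \<T> a (Suc a) \<Longrightarrow> Q a (Suc a)"
    and split: "\<And>a b c. a < c \<Longrightarrow> c < b \<Longrightarrow> b \<le> n \<Longrightarrow> convex hull {p a, p c, p b} \<in> \<T> \<Longrightarrow>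
      Q a c \<Longrightarrow> Q c b \<Longrightarrow> Q a b"
  shows "Q a b"
  using ab
proof (induction "b - a" arbitrary: a b rule: less_induct)
  case less
  then have le: "a < b" "b \<le> n" using n triangulation_edge_le by auto
  show ?case
  proof (cases "b = Suc a")
    case True
    then show ?thesis using less.prems n side by auto
  next
    case False
    then obtain c where c: "a < c" "c < b" "convex hull {p a, p c, p b} \<in> \<T>"
      using polygon_triangulation_step[OF P T, of a b] le less.prems by (metis Suc_lessI)
    have "triangulation_edge n p \<T> a c" "triangulation_edge n p \<T> c b"
      using triangulation_edge_triple[OF c(1,2) le(2) c(3)] by auto
    then have "Q a c" "Q c b" using less.hyps c by (simp_all add: diff_less_mono diff_less_mono2)
    then show ?thesis using split c le by blast
  qed
qed

text \<open>Descending from the root, one of the two sub-edges always still spans the side at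
  \<open>i\<close>.\<close>

lemma triangulation_spine_edge:
  assumes P: "convex_polygon n p" and T: "polygon_triangulation n p \<T>" and n: "n \<ge> 2" and i: "i < n"
  shows "triangulation_edge n p \<T> i (Suc i)"
proof -
  have "a \<le> i \<and> i < b \<longrightarrow> triangulation_edge n p \<T> i (Suc i)"
    if "(a = 0 \<and> b = n) \<or> triangulation_edge n p \<T> a b" for a b
    using P T n that
  proof (induction rule: triangulation_edge_induct)
    case (side a)
    then show ?case by (auto simp: le_less_Suc_eq)
  next
    case (split a b c)
    then show ?case by force
  qed
  from this[of 0 n] i show ?thesis by simp
qed

section \<open>The simplicial subset of a triangulation and restriction to it\<close>

lemma triangulation_simplexE:
  assumes "\<phi> \<in> simp (triangulation_sset n p \<T>) m"
  obtains i j k \<psi> where "i < j" "j < k" "k \<le> n" "convex hull {p i, p j, p k} \<in> \<T>"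
    "\<psi> \<in> delta_hom m 2" "\<phi> = compose {..m} (vertex_map [i, j, k]) \<psi>"
  using assms by (auto simp: triangulation_sset_def generated_subset_def std_simplex_def)

lemma triangulation_simplexI:
  assumes "i < j" "j < k" "k \<le> n" "convex hull {p i, p j, p k} \<in> \<T>" "\<psi> \<in> delta_hom m 2"
  shows "compose {..m} (vertex_map [i, j, k]) \<psi> \<in> simp (triangulation_sset n p \<T>) m"
  using assms by (fastforce simp: triangulation_sset_def generated_subset_def std_simplex_def)

lemma act_triangulation [simp]:
  "act (triangulation_sset n p \<T>) m k \<phi> \<sigma> = compose {..m} \<sigma> \<phi>"
  by (simp add: triangulation_sset_def generated_subset_def std_simplex_def)

lemma triangulation_simplex_delta:
  assumes "\<phi> \<in> simp (triangulation_sset n p \<T>) m"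
  shows "\<phi> \<in> delta_hom m n"
  using assms
  by (rule triangulation_simplexE) (auto intro!: delta_hom_compose[of _ m 2] vertex_map_triple_hom)

lemma triangulation_simplex_compose:
  assumes "\<phi> \<in> delta_hom l m" "\<sigma> \<in> simp (triangulation_sset n p \<T>) m"
  shows "compose {..l} \<sigma> \<phi> \<in> simp (triangulation_sset n p \<T>) l"
  using assms(2)
proof (rule triangulation_simplexE)
  fix i j k \<psi>
  assume *: "i < j" "j < k" "k \<le> n" "convex hull {p i, p j, p k} \<in> \<T>"
    "\<psi> \<in> delta_hom m 2" "\<sigma> = compose {..m} (vertex_map [i, j, k]) \<psi>"
  show ?thesis
    unfolding *(6) compose_delta_assoc[OF assms(1)]
    by (rule triangulation_simplexI[OF *(1-4) delta_hom_compose[OF assms(1) *(5)]])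
qed

lemma triangulation_triangle_simplex:
  assumes "i < j" "j < k" "k \<le> n" "convex hull {p i, p j, p k} \<in> \<T>"
  shows "vertex_map [i, j, k] \<in> simp (triangulation_sset n p \<T>) 2"
proof -
  have "(\<lambda>i\<in>{..2}. i) \<in> delta_hom 2 2" by (rule delta_homI) auto
  moreover have "compose {..2} (vertex_map [i, j, k]) (\<lambda>i\<in>{..2}. i) = vertex_map [i, j, k]"
    by (auto simp: fun_eq_iff compose_def vertex_map_triple_apply)
  ultimately show ?thesis using triangulation_simplexI[OF assms] by metis
qed

lemma triangulation_edge_simplex:
  assumes "triangulation_edge n p \<T> a b"
  shows "vertex_map [a, b] \<in> simp (triangulation_sset n p \<T>) 1"
proof -
  obtain i j k where ijk: "i < j" "j < k" "k \<le> n" "convex hull {p i, p j, p k} \<in> \<T>"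
    and ab: "a < b" "{a, b} \<subseteq> {i, j, k}"
    using assms unfolding triangulation_edge_def by blast
  let ?v = "vertex_map [i, j, k]"
  obtain s t where "s \<le> t" "t \<le> 2" "?v s = a" "?v t = b"
    using ab ijk that[of 0 1] that[of 0 2] that[of 1 2] by (auto simp: vertex_map_triple_apply)
  then show ?thesis
    using triangulation_simplex_compose[OF vertex_map_pair_hom triangulation_triangle_simplex[OF ijk]]
    by (metis compose_vertex_map_pair)
qed

lemma restrict_simplex_hom:
  assumes X: "simplicial_set X" and x: "x \<in> simp X n"
  shows "restrict_simplex X n (triangulation_sset n p \<T>) x \<in> sset_hom (triangulation_sset n p \<T>) X"
proof (rule sset_homI)
  fix m \<phi> assume "\<phi> \<in> simp (triangulation_sset n p \<T>) m"
  then show "restrict_simplex X n (triangulation_sset n p \<T>) x m \<phi> \<in> simp X m"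
    using act_closed[OF X _ x] triangulation_simplex_delta by (fastforce simp: restrict_simplex_def)
next
  fix m k \<phi> \<sigma> assume *: "\<phi> \<in> delta_hom m k" "\<sigma> \<in> simp (triangulation_sset n p \<T>) k"
  then show "restrict_simplex X n (triangulation_sset n p \<T>) x m (act (triangulation_sset n p \<T>) m k \<phi> \<sigma>)
      = act X m k \<phi> (restrict_simplex X n (triangulation_sset n p \<T>) x k \<sigma>)"
    using act_comp[OF X *(1) triangulation_simplex_delta[OF *(2)] x]
    by (simp add: restrict_simplex_def triangulation_simplex_compose)
qed (simp add: restrict_simplex_def)

text \<open>All polygon sides are simplices of the triangulation, so the restriction still sees the
  spine.\<close>

lemma inj_restrict_nerve:
  assumes P: "convex_polygon n p" and T: "polygon_triangulation n p \<T>" and n: "n \<ge> 2"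
  shows "inj_on (restrict_simplex (nerve M) n (triangulation_sset n p \<T>)) (simp (nerve M) n)"
proof (rule inj_onI)
  fix x y assume x: "x \<in> simp (nerve M) n" and y: "y \<in> simp (nerve M) n"
    and eq: "restrict_simplex (nerve M) n (triangulation_sset n p \<T>) x
      = restrict_simplex (nerve M) n (triangulation_sset n p \<T>) y"
  show "x = y"
  proof (rule DD_hom_eq_spineI[of x n M y])
    fix i assume i: "i < n"
    have "vertex_map [i, Suc i] \<in> simp (triangulation_sset n p \<T>) 1"
      by (intro triangulation_edge_simplex triangulation_spine_edge[OF P T n i])
    then have "act (nerve M) 1 n (vertex_map [i, Suc i]) x = act (nerve M) 1 n (vertex_map [i, Suc i]) y"
      using fun_cong[OF fun_cong[OF eq, of 1], of "vertex_map [i, Suc i]"]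
      by (simp add: restrict_simplex_def)
    then show "x (dm i (Suc i)) = y (dm i (Suc i))"
      using nerve_edge[of i "Suc i" n M x] nerve_edge[of i "Suc i" n M y] i by simp
  qed (use x y in auto)
qed

text \<open>The triangulation read from the edge \<open>0n\<close> inwards is a bracketing under which the word of
  spine labels is defined; hence so are the products of all subwords.\<close>

lemma surj_restrict_nerve:
  assumes M: "partial_unital_magma M" "pm_assoc M"
    and P: "convex_polygon n p" and T: "polygon_triangulation n p \<T>" and n: "n \<ge> 2"
    and h: "h \<in> sset_hom (triangulation_sset n p \<T>) (nerve M)"
  shows "\<exists>x\<in>simp (nerve M) n. restrict_simplex (nerve M) n (triangulation_sset n p \<T>) x = h"
proof -
  define A where "A = triangulation_sset n p \<T>"
  note h' = h[folded A_def]
  define e where "e = (\<lambda>a b. h 1 (vertex_map [a, b]) (dm 0 1))"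
  have hm: "h m \<phi> \<in> pm_hom (DD m) M" if "\<phi> \<in> simp A m" for m \<phi>
    using sset_hom_closed[OF h' that] by simp
  have h_edge: "h 2 (vertex_map [i, j, k]) (dm s t) = e (vertex_map [i, j, k] s) (vertex_map [i, j, k] t)"
    if "i < j" "j < k" "k \<le> n" "convex hull {p i, p j, p k} \<in> \<T>" "s \<le> t" "t \<le> 2" for i j k s t
  proof -
    let ?v = "vertex_map [i, j, k]"
    have "h 2 ?v (dm s t) = act (nerve M) 1 2 (vertex_map [s, t]) (h 2 ?v) (dm 0 1)"
      by (rule nerve_edge[OF that(5,6), symmetric])
    also have "act (nerve M) 1 2 (vertex_map [s, t]) (h 2 ?v) = h 1 (act A 1 2 (vertex_map [s, t]) ?v)"
      using sset_hom_act[OF h' vertex_map_pair_hom[OF that(5,6)]]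
        triangulation_triangle_simplex[OF that(1-4)] by (simp add: A_def)
    also have "act A 1 2 (vertex_map [s, t]) ?v = vertex_map [?v s, ?v t]"
      by (simp add: A_def compose_vertex_map_pair)
    finally show ?thesis by (simp add: e_def)
  qed
  have e_mul: "pmul M (e i j) (e j k) = Some (e i k)"
    if "i < j" "j < k" "k \<le> n" "convex hull {p i, p j, p k} \<in> \<T>" for i j k
    using DD_hom_pmul[OF hm[of "vertex_map [i, j, k]" 2], of 0 1 2] triangulation_triangle_simplex[OF that]
      h_edge[OF that, of 0 1] h_edge[OF that, of 1 2] h_edge[OF that, of 0 2]
    by (simp add: A_def vertex_map_triple_apply)
  \<comment> \<open>Kept as an option: for pairs that are not edges of the triangulation,
    definedness is still to be shown.\<close>
  define W where "W = (\<lambda>a b. word_prod M (map (\<lambda>l. e l (Suc l)) [a..<b]))"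
  have W_append: "W a c = omul M (W a b) (W b c)" if "a \<le> b" "b \<le> c" for a b c
  proof -
    have "[a..<c] = [a..<b] @ [b..<c]" using that by (metis le_Suc_ex upt_add_eq_append)
    then show ?thesis by (simp add: W_def word_prod_append[OF M])
  qed
  have W_edge: "W a b = Some (e a b)" if "(a = 0 \<and> b = n) \<or> triangulation_edge n p \<T> a b" for a b
    using P T n that
  proof (induction rule: triangulation_edge_induct)
    case (side a)
    have "e a (Suc a) \<in> elems M"
      using DD_hom_elems[OF hm[of "vertex_map [a, Suc a]" 1], of 0 1] triangulation_edge_simplex[OF side]
      by (simp add: A_def e_def)
    then show ?case by (simp add: W_def pmul_pone[OF M(1)])
  next
    case (split a b c)
    then show ?case by (simp add: W_append[of a c b] e_mul)
  qed
  \<comment> \<open>The full word is defined, since its interval is the root edge; it factors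
    through every subword, and undefinedness is absorbing.\<close>
  have W_def': "W a b \<noteq> None" if "a \<le> b" "b \<le> n" for a b
  proof -
    have "W 0 n = omul M (W 0 a) (omul M (W a b) (W b n))"
      using that W_append[of 0 a n] W_append[of a b n] by simp
    then show ?thesis using W_edge[of 0 n] by (cases "W a b") auto
  qed
  define G where "G = (\<lambda>a b. the (W a b))"
  define x where "x = DD_hom_of n G"
  have WG: "W a b = Some (G a b)" if "a \<le> b" "b \<le> n" for a b
    using W_def'[OF that] by (auto simp: G_def)
  have G_same: "G a a = pone M" for a by (simp add: G_def W_def)
  have x: "x \<in> pm_hom (DD n) M"
    unfolding x_def
  proof (rule DD_hom_of_hom[OF M(1)])
    show "G i j \<in> elems M" if "i < j" "j \<le> n" for i j
      using word_prod_elems[OF M(1)] WG[of i j] that by (simp add: W_def)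
    show "pmul M (G i j) (G j k) = Some (G i k)" if "i < j" "j < k" "k \<le> n" for i j k
      using W_append[of i j k] WG[of i j] WG[of j k] WG[of i k] that by simp
  qed (rule G_same)
  have x_edge: "x (dm a b) = e a b" if "triangulation_edge n p \<T> a b" for a b
    using W_edge[of a b] WG[of a b] triangulation_edge_le[OF that] that
      DD_hom_of_dm[of n G "pone M" a b] G_same by (simp add: x_def)
  \<comment> \<open>Triangles generate the subset, so agreement there suffices, and each of their
    edges is an edge of the triangulation.\<close>
  have tri: "act (nerve M) 2 n (vertex_map [i, j, k]) x = h 2 (vertex_map [i, j, k])"
    if "i < j" "j < k" "k \<le> n" "convex hull {p i, p j, p k} \<in> \<T>" for i j k
  proof (rule DD_hom_eqI[of _ 2 M])
    have v: "vertex_map [i, j, k] \<in> delta_hom 2 n" using that by (intro vertex_map_triple_hom) auto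
    show "act (nerve M) 2 n (vertex_map [i, j, k]) x \<in> pm_hom (DD 2) M"
      by (rule act_nerve_closed[OF v x])
    show "h 2 (vertex_map [i, j, k]) \<in> pm_hom (DD 2) M"
      using triangulation_triangle_simplex[OF that] by (intro hm) (simp add: A_def)
    fix s t :: nat assume st: "s < t" "t \<le> 2"
    then consider "s = 0" "t = 1" | "s = 0" "t = 2" | "s = 1" "t = 2" by force
    then have "triangulation_edge n p \<T> (vertex_map [i, j, k] s) (vertex_map [i, j, k] t)"
      using triangulation_edge_triple[OF that] by cases (auto simp: vertex_map_triple_apply)
    then show "act (nerve M) 2 n (vertex_map [i, j, k]) x (dm s t) = h 2 (vertex_map [i, j, k]) (dm s t)"
      using st h_edge[OF that, of s t] by (simp add: act_nerve_dm[OF v] x_edge)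
  qed
  have "restrict_simplex (nerve M) n A x = h"
  proof (rule sset_hom_eqI[OF _ h'])
    show "restrict_simplex (nerve M) n A x \<in> sset_hom A (nerve M)"
      unfolding A_def using x by (intro restrict_simplex_hom simplicial_set_nerve) simp
    fix m \<phi> assume \<phi>: "\<phi> \<in> simp A m"
    obtain i j k \<psi> where ijk: "i < j" "j < k" "k \<le> n" "convex hull {p i, p j, p k} \<in> \<T>"
      and \<psi>: "\<psi> \<in> delta_hom m 2" and \<phi>_eq: "\<phi> = compose {..m} (vertex_map [i, j, k]) \<psi>"
      using \<phi> unfolding A_def by (rule triangulation_simplexE)
    have v: "vertex_map [i, j, k] \<in> delta_hom 2 n" using ijk by (intro vertex_map_triple_hom) auto
    have "restrict_simplex (nerve M) n A x m \<phi> = act (nerve M) m n \<phi> x"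
      using \<phi> by (simp add: restrict_simplex_def)
    also have "\<dots> = act (nerve M) m 2 \<psi> (h 2 (vertex_map [i, j, k]))"
      using act_comp[OF simplicial_set_nerve \<psi> v, of x M] x by (simp add: \<phi>_eq tri[OF ijk])
    also have "\<dots> = h m \<phi>"
      using sset_hom_act[OF h' \<psi>, of "vertex_map [i, j, k]"] triangulation_triangle_simplex[OF ijk]
      by (simp add: \<phi>_eq A_def)
    finally show "restrict_simplex (nerve M) n A x m \<phi> = h m \<phi>" .
  qed
  then show ?thesis using x by (auto simp: A_def)
qed

lemma two_segal_nerve:
  assumes M: "partial_unital_magma M" "pm_assoc M"
  shows "two_segal (nerve M)"
  unfolding two_segal_def bij_betw_def
proof (intro allI impI conjI)
  fix n p \<T> assume n: "3 \<le> n" and PT: "convex_polygon n p \<and> polygon_triangulation n p \<T>"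
  show "inj_on (restrict_simplex (nerve M) n (triangulation_sset n p \<T>)) (simp (nerve M) n)"
    using PT n by (intro inj_restrict_nerve) auto
  show "restrict_simplex (nerve M) n (triangulation_sset n p \<T>) ` simp (nerve M) n
      = sset_hom (triangulation_sset n p \<T>) (nerve M)"
  proof
    show "restrict_simplex (nerve M) n (triangulation_sset n p \<T>) ` simp (nerve M) n
        \<subseteq> sset_hom (triangulation_sset n p \<T>) (nerve M)"
      by (intro image_subsetI restrict_simplex_hom simplicial_set_nerve)
    show "sset_hom (triangulation_sset n p \<T>) (nerve M)
        \<subseteq> restrict_simplex (nerve M) n (triangulation_sset n p \<T>) ` simp (nerve M) n"
    proof
      fix h assume "h \<in> sset_hom (triangulation_sset n p \<T>) (nerve M)"
      then obtain x where "x \<in> simp (nerve M) n"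
        "restrict_simplex (nerve M) n (triangulation_sset n p \<T>) x = h"
        using surj_restrict_nerve[OF M conjunct1[OF PT] conjunct2[OF PT]] n by auto
      then show "h \<in> restrict_simplex (nerve M) n (triangulation_sset n p \<T>) ` simp (nerve M) n"
        by blast
    qed
  qed
qed


section \<open>Invariance under isomorphism\<close>

lemma spiny_iso:
  assumes iso: "sset_iso X Y" and X: "spiny X" and Y: "simplicial_set Y"
  shows "spiny Y"
  unfolding spiny_def
proof (intro allI impI inj_onI)
  obtain f g where g: "g \<in> sset_hom Y X" and fg: "\<And>n y. y \<in> simp Y n \<Longrightarrow> f n (g n y) = y"
    using iso by (rule sset_isoE) blast
  fix n y z assume n: "2 \<le> n" and yz: "y \<in> simp Y n" "z \<in> simp Y n"
    and eq: "spine_map Y n y = spine_map Y n z"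
  have spine: "act X 1 n (vertex_map [i, Suc i]) (g n w) = g 1 (spine_map Y n w i)"
    if "i < n" "w \<in> simp Y n" for i w
    using sset_hom_act[OF g vertex_map_pair_hom, of i "Suc i" n w] that by (simp add: spine_map_def)
  have "spine_map X n (g n y) = spine_map X n (g n z)"
    using spine yz eq by (auto simp: spine_map_def[of X])
  then have "g n y = g n z"
    using X n sset_hom_closed[OF g] yz unfolding spiny_def inj_on_def by blast
  then show "y = z" using fg yz by metis
qed

lemma reduced_iso:
  assumes iso: "sset_iso X Y" and X: "reduced_sset X"
  shows "reduced_sset Y"
proof -
  obtain f g where f: "f \<in> sset_hom X Y" and g: "g \<in> sset_hom Y X"
    and fg: "\<And>n y. y \<in> simp Y n \<Longrightarrow> f n (g n y) = y"
    using iso by (rule sset_isoE) blast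
  obtain x where x: "simp X 0 = {x}" using X by (auto simp: reduced_sset_def is_singleton_def)
  have "y = f 0 x" if "y \<in> simp Y 0" for y
    using fg[OF that] sset_hom_closed[OF g that] x by simp
  moreover have "f 0 x \<in> simp Y 0"
    using x by (intro sset_hom_closed[OF f]) simp
  ultimately have "simp Y 0 = {f 0 x}" by blast
  then show ?thesis by (auto simp: reduced_sset_def is_singleton_def)
qed

text \<open>Simplicial maps commute with restriction. A map into \<open>Y\<close> is sent to
  \<open>X\<close> by \<open>g\<close>, extended there, and the extension is brought back by
  \<open>f\<close>.\<close>

lemma two_segal_iso:
  assumes iso: "sset_iso X Y" and X: "two_segal X" and Y: "simplicial_set Y"
  shows "two_segal Y"
  unfolding two_segal_def
proof (intro allI impI)
  obtain f g where f: "f \<in> sset_hom X Y" and g: "g \<in> sset_hom Y X"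
    and fg: "\<And>n y. y \<in> simp Y n \<Longrightarrow> f n (g n y) = y"
    using iso by (rule sset_isoE) blast
  fix n p \<T> assume n: "3 \<le> n" and PT: "convex_polygon n p \<and> polygon_triangulation n p \<T>"
  define A where "A = triangulation_sset n p \<T>"
  have bij: "bij_betw (restrict_simplex X n A) (simp X n) (sset_hom A X)"
    using X n PT unfolding two_segal_def A_def by blast
  have delta: "\<phi> \<in> delta_hom m n" if "\<phi> \<in> simp A m" for m \<phi>
    using that triangulation_simplex_delta by (simp add: A_def)
  have g_restrict: "restrict_simplex X n A (g n y) m \<phi> = g m (restrict_simplex Y n A y m \<phi>)"
    if "\<phi> \<in> simp A m" "y \<in> simp Y n" for m \<phi> y
    using that sset_hom_act[OF g delta[OF that(1)] that(2)] by (simp add: restrict_simplex_def)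
  have inj: "inj_on (restrict_simplex Y n A) (simp Y n)"
  proof (rule inj_onI)
    fix y z assume yz: "y \<in> simp Y n" "z \<in> simp Y n" and eq: "restrict_simplex Y n A y = restrict_simplex Y n A z"
    have "restrict_simplex X n A (g n y) m \<phi> = restrict_simplex X n A (g n z) m \<phi>" for m \<phi>
    proof (cases "\<phi> \<in> simp A m")
      case True
      then show ?thesis using yz eq by (simp add: g_restrict)
    qed (simp add: restrict_simplex_def)
    then have "restrict_simplex X n A (g n y) = restrict_simplex X n A (g n z)" by blast
    then have "g n y = g n z"
      using bij sset_hom_closed[OF g] yz unfolding bij_betw_def inj_on_def by blast
    then show "y = z" using fg yz by metis
  qed
  have "\<exists>y\<in>simp Y n. restrict_simplex Y n A y = h" if h: "h \<in> sset_hom A Y" for h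
  proof -
    have "sset_comp A g h \<in> sset_hom A X"
      by (rule sset_comp_hom[OF h g]) (simp add: A_def triangulation_simplex_compose)
    then obtain x where x: "x \<in> simp X n" "restrict_simplex X n A x = sset_comp A g h"
      using bij unfolding bij_betw_def by (metis imageE)
    have fx: "f n x \<in> simp Y n" by (rule sset_hom_closed[OF f x(1)])
    have "restrict_simplex Y n A (f n x) = h"
    proof (rule sset_hom_eqI[OF _ h])
      show "restrict_simplex Y n A (f n x) \<in> sset_hom A Y"
        unfolding A_def by (rule restrict_simplex_hom[OF Y fx])
      fix m \<phi> assume \<phi>: "\<phi> \<in> simp A m"
      have "restrict_simplex Y n A (f n x) m \<phi> = f m (act X m n \<phi> x)"
        using \<phi> sset_hom_act[OF f delta[OF \<phi>] x(1)] by (simp add: restrict_simplex_def)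
      also have "act X m n \<phi> x = g m (h m \<phi>)"
        using fun_cong[OF fun_cong[OF x(2), of m], of \<phi>] \<phi>
        by (simp add: restrict_simplex_def sset_comp_def compose_def)
      also have "f m (g m (h m \<phi>)) = h m \<phi>" by (rule fg[OF sset_hom_closed[OF h \<phi>]])
      finally show "restrict_simplex Y n A (f n x) m \<phi> = h m \<phi>" .
    qed
    with fx show ?thesis by blast
  qed
  moreover have "restrict_simplex Y n A y \<in> sset_hom A Y" if "y \<in> simp Y n" for y
    unfolding A_def by (rule restrict_simplex_hom[OF Y that])
  ultimately have "restrict_simplex Y n A ` simp Y n = sset_hom A Y" by blast
  with inj show "bij_betw (restrict_simplex Y n (triangulation_sset n p \<T>)) (simp Y n)
      (sset_hom (triangulation_sset n p \<T>) Y)"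
    by (simp add: bij_betw_def A_def)
qed


section \<open>The partial monoid of edges\<close>

definition edge :: "'x sset \<Rightarrow> nat \<Rightarrow> 'x \<Rightarrow> nat \<Rightarrow> nat \<Rightarrow> 'x" where
  "edge X n x i j = act X 1 n (vertex_map [i, j]) x"

text \<open>The choice operator only makes the definition total: spininess leaves at most one
  candidate. The unit is the degenerate edge at the only vertex.\<close>

definition edge_monoid :: "'x sset \<Rightarrow> 'x pmagma" where
  "edge_monoid X =
     \<lparr>elems = simp X 1,
      pone = act X 1 0 (\<lambda>i\<in>{..1}. 0) (the_elem (simp X 0)),
      pmul = (\<lambda>a b. if \<exists>\<sigma>\<in>simp X 2. edge X 2 \<sigma> 0 1 = a \<and> edge X 2 \<sigma> 1 2 = b
        then Some (edge X 2 (SOME \<sigma>. \<sigma> \<in> simp X 2 \<and> edge X 2 \<sigma> 0 1 = a \<and> edge X 2 \<sigma> 1 2 = b) 0 2)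
        else None)\<rparr>"

locale spiny_reduced =
  fixes X :: "'x sset"
  assumes simplicial: "simplicial_set X" and spiny: "spiny X" and reduced: "reduced_sset X"
begin

abbreviation "K \<equiv> edge_monoid X"

lemma elems_K: "elems K = simp X 1"
  by (simp add: edge_monoid_def)

lemma edge_closed: "x \<in> simp X n \<Longrightarrow> i \<le> j \<Longrightarrow> j \<le> n \<Longrightarrow> edge X n x i j \<in> simp X 1"
  unfolding edge_def by (intro act_closed[OF simplicial] vertex_map_pair_hom)

lemma edge_act:
  assumes "\<phi> \<in> delta_hom n k" "x \<in> simp X k" "i \<le> j" "j \<le> n"
  shows "edge X n (act X n k \<phi> x) i j = edge X k x (\<phi> i) (\<phi> j)"
  unfolding edge_def act_comp[OF simplicial vertex_map_pair_hom[OF assms(3,4)] assms(1,2)]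
    compose_vertex_map_pair ..

lemma edge_self: "x \<in> simp X 1 \<Longrightarrow> edge X 1 x 0 1 = x"
  unfolding edge_def vertex_map_01 by (rule act_id[OF simplicial])

text \<open>A constant edge factors through a vertex, and there is only one vertex.\<close>

lemma edge_same:
  assumes "x \<in> simp X n" "i \<le> n"
  shows "edge X n x i i = pone K"
proof -
  have c: "(\<lambda>i\<in>{..1}. 0) \<in> delta_hom 1 0" and v: "vertex_map [i] \<in> delta_hom 0 n"
    using assms(2) by (auto intro!: delta_homI simp: vertex_map_def)
  have "vertex_map [i, i] = compose {..1} (vertex_map [i]) (\<lambda>i\<in>{..1}. 0)"
    by (auto simp: fun_eq_iff compose_def vertex_map_pair_apply vertex_map_single_apply)
  then have "edge X n x i i = act X 1 0 (\<lambda>i\<in>{..1}. 0) (act X 0 n (vertex_map [i]) x)"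
    by (simp add: edge_def act_comp[OF simplicial c v assms(1)])
  also have "act X 0 n (vertex_map [i]) x = the_elem (simp X 0)"
    using reduced act_closed[OF simplicial v assms(1)]
    by (auto simp: reduced_sset_def is_singleton_def)
  also have "act X 1 0 (\<lambda>i\<in>{..1}. 0) (the_elem (simp X 0)) = pone K"
    by (simp add: edge_monoid_def)
  finally show ?thesis .
qed

text \<open>Spininess starts in dimension 2. Reducedness settles dimension 0, and a 1-simplex is its
  own edge.\<close>

lemma edges_inj:
  assumes x: "x \<in> simp X n" and y: "y \<in> simp X n"
    and eq: "\<And>i. i < n \<Longrightarrow> edge X n x i (Suc i) = edge X n y i (Suc i)"
  shows "x = y"
proof -
  consider "n = 0" | "n = 1" | "n \<ge> 2" by linarith
  then show ?thesis
  proof cases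
    case 1
    then show ?thesis using x y reduced by (auto simp: reduced_sset_def is_singleton_def)
  next
    case 2
    then show ?thesis using edge_self[of x] edge_self[of y] x y eq[of 0] by (simp add: One_nat_def)
  next
    case 3
    have "spine_map X n x = spine_map X n y"
      using eq by (auto simp: spine_map_def edge_def)
    then show ?thesis using spiny 3 x y by (auto simp: spiny_def inj_on_def)
  qed
qed

lemma pmul_K_iff:
  "pmul K a b = Some c \<longleftrightarrow>
    (\<exists>\<sigma>\<in>simp X 2. edge X 2 \<sigma> 0 1 = a \<and> edge X 2 \<sigma> 1 2 = b \<and> edge X 2 \<sigma> 0 2 = c)"
proof -
  let ?Q = "\<lambda>\<sigma>. \<sigma> \<in> simp X 2 \<and> edge X 2 \<sigma> 0 1 = a \<and> edge X 2 \<sigma> 1 2 = b"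
  have uniq: "\<sigma> = \<tau>" if "?Q \<sigma>" "?Q \<tau>" for \<sigma> \<tau>
    using that by (intro edges_inj[of \<sigma> 2 \<tau>]) (auto dest!: less_2_cases simp: One_nat_def[symmetric])
  show ?thesis
  proof (cases "\<exists>\<sigma>. ?Q \<sigma>")
    case True
    then obtain \<sigma> where \<sigma>: "?Q \<sigma>" by blast
    have "(SOME \<sigma>. ?Q \<sigma>) = \<sigma>"
      by (rule some_equality[of ?Q, OF \<sigma> uniq[OF _ \<sigma>]])
    moreover have "\<exists>\<sigma>\<in>simp X 2. edge X 2 \<sigma> 0 1 = a \<and> edge X 2 \<sigma> 1 2 = b" using \<sigma> by blast
    ultimately have m: "pmul K a b = Some (edge X 2 \<sigma> 0 2)"
      by (simp add: edge_monoid_def)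
    show ?thesis
    proof
      assume "pmul K a b = Some c"
      then show "\<exists>\<sigma>\<in>simp X 2. edge X 2 \<sigma> 0 1 = a \<and> edge X 2 \<sigma> 1 2 = b \<and> edge X 2 \<sigma> 0 2 = c"
        using m \<sigma> by auto
    next
      assume "\<exists>\<sigma>\<in>simp X 2. edge X 2 \<sigma> 0 1 = a \<and> edge X 2 \<sigma> 1 2 = b \<and> edge X 2 \<sigma> 0 2 = c"
      then obtain \<tau> where "?Q \<tau>" "edge X 2 \<tau> 0 2 = c" by blast
      then show "pmul K a b = Some c" using m uniq[OF \<sigma>, of \<tau>] by simp
    qed
  next
    case False
    then have "pmul K a b = None" by (auto simp: edge_monoid_def)
    then show ?thesis using False by auto
  qed
qed

text \<open>The witness is the face on \<open>i\<close>, \<open>j\<close>, \<open>k\<close>.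
  Repeated vertices are allowed, and the resulting degenerate faces give the unit laws of
  \<open>K\<close>.\<close>

lemma edge_pmul:
  assumes x: "x \<in> simp X n" and "i \<le> j" "j \<le> k" "k \<le> n"
  shows "pmul K (edge X n x i j) (edge X n x j k) = Some (edge X n x i k)"
proof -
  note v = vertex_map_triple_hom[OF assms(2-4)]
  show ?thesis
    unfolding pmul_K_iff
    using act_closed[OF simplicial v x] edge_act[OF v x, of 0 1] edge_act[OF v x, of 1 2] edge_act[OF v x, of 0 2]
    by (intro bexI[of _ "act X 2 n (vertex_map [i, j, k]) x"]) (auto simp: vertex_map_triple_apply)
qed

lemma K_unital: "partial_unital_magma K"
  unfolding partial_unital_magma_def
proof (intro conjI allI impI ballI)
  obtain e where e: "e \<in> simp X 0" using reduced by (auto simp: reduced_sset_def is_singleton_def)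
  show "pone K \<in> elems K"
    using edge_same[OF e, of 0] edge_closed[OF e, of 0 0] by (simp add: elems_K)
  fix m assume m: "m \<in> elems K"
  then have m: "m \<in> simp X 1" by (simp add: elems_K)
  show "pmul K m (pone K) = Some m"
    using edge_pmul[OF m, of 0 1 1] edge_self[OF m] edge_same[OF m, of 1] by simp
  show "pmul K (pone K) m = Some m"
    using edge_pmul[OF m, of 0 0 1] edge_self[OF m] edge_same[OF m, of 0] by simp
next
  fix a b c assume "pmul K a b = Some c"
  then show "a \<in> elems K" "b \<in> elems K" "c \<in> elems K"
    unfolding pmul_K_iff elems_K by (auto intro: edge_closed)
qed

lemma edge_DD_hom:
  assumes "x \<in> simp X n"
  shows "DD_hom_of n (edge X n x) \<in> pm_hom (DD n) K"
  by (rule DD_hom_of_hom[OF K_unital])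
    (auto simp: elems_K edge_same[OF assms] edge_closed[OF assms] edge_pmul[OF assms])

lemma edge_DD_hom_dm:
  assumes "x \<in> simp X n" "i \<le> j" "j \<le> n"
  shows "DD_hom_of n (edge X n x) (dm i j) = edge X n x i j"
  by (rule DD_hom_of_dm[OF edge_same[OF assms(1)] assms(2,3)])

text \<open>Turns edge labels into a simplicial map. Since a simplex of the subset may come from
  several triangles, its image is fixed by a relation \<open>R\<close> on edges that mentions no
  triangle; \<open>edges_inj\<close> makes that image unique and hence natural.\<close>

lemma two_segal_realize:
  assumes X: "two_segal X" and n: "n \<ge> 3"
    and P: "convex_polygon n p" and T: "polygon_triangulation n p \<T>"
    and G_same: "\<And>i. G i i = pone K"
    and G: "\<And>i j k. i < j \<Longrightarrow> j < k \<Longrightarrow> k \<le> n \<Longrightarrow> convex hull {p i, p j, p k} \<in> \<T> \<Longrightarrow>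
      pmul K (G i j) (G j k) = Some (G i k)"
  obtains x where "x \<in> simp X n" "\<And>a b. triangulation_edge n p \<T> a b \<Longrightarrow> edge X n x a b = G a b"
proof -
  define A where "A = triangulation_sset n p \<T>"
  \<comment> \<open>\<open>\<phi>\<close> may identify vertices, which is why \<open>G\<close> is
    prescribed on the diagonal as well.\<close>
  define R where "R = (\<lambda>m \<phi> y. y \<in> simp X m \<and> (\<forall>s t. s \<le> t \<and> t \<le> m \<longrightarrow> edge X m y s t = G (\<phi> s) (\<phi> t)))"
  have R_unique: "y = z" if "R m \<phi> y" "R m \<phi> z" for m \<phi> y z
    using that by (intro edges_inj[of y m z]) (auto simp: R_def)
  have R_ex: "\<exists>y. R m \<phi> y" if \<phi>: "\<phi> \<in> simp A m" for m \<phi>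
  proof -
    obtain i j k \<psi> where ijk: "i < j" "j < k" "k \<le> n" "convex hull {p i, p j, p k} \<in> \<T>"
      and \<psi>: "\<psi> \<in> delta_hom m 2" and \<phi>_eq: "\<phi> = compose {..m} (vertex_map [i, j, k]) \<psi>"
      using \<phi> unfolding A_def by (rule triangulation_simplexE)
    let ?v = "vertex_map [i, j, k]"
    obtain \<sigma> where \<sigma>: "\<sigma> \<in> simp X 2" "edge X 2 \<sigma> 0 1 = G i j" "edge X 2 \<sigma> 1 2 = G j k"
      "edge X 2 \<sigma> 0 2 = G i k"
      using G[OF ijk] unfolding pmul_K_iff by blast
    have \<sigma>_edge: "edge X 2 \<sigma> s t = G (?v s) (?v t)" if "s \<le> t" "t \<le> 2" for s t
    proof (cases "s = t")
      case True
      then show ?thesis using edge_same[OF \<sigma>(1)] that G_same by simp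
    next
      case False
      with that consider "s = 0" "t = 1" | "s = 0" "t = 2" | "s = 1" "t = 2" by force
      then show ?thesis using \<sigma> by cases (auto simp: vertex_map_triple_apply)
    qed
    have "R m \<phi> (act X m 2 \<psi> \<sigma>)"
      using act_closed[OF simplicial \<psi> \<sigma>(1)] delta_hom_le[OF \<psi>] delta_hom_mono[OF \<psi>]
      by (auto simp: R_def edge_act[OF \<psi> \<sigma>(1)] \<phi>_eq compose_def \<sigma>_edge)
    then show ?thesis ..
  qed
  define h where "h = (\<lambda>m. \<lambda>\<phi>\<in>simp A m. SOME y. R m \<phi> y)"
  have h_R: "R m \<phi> (h m \<phi>)" if "\<phi> \<in> simp A m" for m \<phi>
    using someI_ex[OF R_ex[OF that]] that by (simp add: h_def)
  have "h \<in> sset_hom A X"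
  proof (rule sset_homI)
    show "h m \<phi> \<in> simp X m" if "\<phi> \<in> simp A m" for m \<phi>
      using h_R[OF that] by (simp add: R_def)
    fix m k \<psi> \<phi> assume *: "\<psi> \<in> delta_hom m k" "\<phi> \<in> simp A k"
    have comp: "compose {..m} \<phi> \<psi> \<in> simp A m"
      using triangulation_simplex_compose[OF *(1)] *(2) by (simp add: A_def)
    have hk: "h k \<phi> \<in> simp X k" using h_R[OF *(2)] by (simp add: R_def)
    \<comment> \<open>The restricted image satisfies the relation that characterises
      \<open>h\<close> at the restricted simplex, so uniqueness gives naturality.\<close>
    have "R m (compose {..m} \<phi> \<psi>) (act X m k \<psi> (h k \<phi>))"
      using h_R[OF *(2)] delta_hom_le[OF *(1)] delta_hom_mono[OF *(1)] act_closed[OF simplicial *(1) hk]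
      by (auto simp: R_def edge_act[OF *(1) hk] compose_def)
    then show "h m (act A m k \<psi> \<phi>) = act X m k \<psi> (h k \<phi>)"
      using R_unique h_R[OF comp] by (simp add: A_def)
  qed (simp add: h_def)
  moreover have "bij_betw (restrict_simplex X n A) (simp X n) (sset_hom A X)"
    using X n P T unfolding two_segal_def A_def by blast
  ultimately obtain x where x: "x \<in> simp X n" "restrict_simplex X n A x = h"
    unfolding bij_betw_def by (metis imageE)
  have "edge X n x a b = G a b" if "triangulation_edge n p \<T> a b" for a b
  proof -
    have v: "vertex_map [a, b] \<in> simp A 1" using triangulation_edge_simplex[OF that] by (simp add: A_def)
    have "edge X n x a b = h 1 (vertex_map [a, b])"
      using fun_cong[OF fun_cong[OF x(2), of 1], of "vertex_map [a, b]"] v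
      by (simp add: restrict_simplex_def edge_def)
    also have "\<dots> = edge X 1 (h 1 (vertex_map [a, b])) 0 1"
      using h_R[OF v] by (simp add: R_def edge_self)
    also have "\<dots> = G a b" using h_R[OF v] by (simp add: R_def vertex_map_pair_apply)
    finally show ?thesis .
  qed
  with x(1) show ?thesis using that by blast
qed

text \<open>Two faces of a 3-simplex, glued along the diagonal 02, carry the given products; its
  other two faces supply \<open>b\<close> times \<open>c\<close> and then \<open>a\<close> times the
  result.\<close>

lemma K_assoc_right:
  assumes X: "two_segal X" and "pmul K a b = Some u" "pmul K u c = Some d"
  shows "omul K (Some a) (pmul K b c) = Some d"
proof -
  \<comment> \<open>Sides 01, 12, 23 carry \<open>a\<close>, \<open>b\<close>, \<open>c\<close>, the
    diagonal 02 carries \<open>u\<close>, and 03 carries \<open>d\<close>. The value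
    \<open>b\<close> on 13 is a filler: no triangle of this fan has that edge.\<close>
  define G where "G = (\<lambda>i j :: nat. if i = j then pone K else if j = 1 then a else if i = 1 then b
    else if i = 2 then c else if j = 2 then u else d)"
  have P: "convex_polygon 3 parabola" by (rule convex_polygon_parabola)
  have T: "polygon_triangulation 3 parabola (fan parabola 3)" by (rule fan_triangulation[OF P]) simp
  obtain x where x: "x \<in> simp X 3"
    and e: "\<And>a b. triangulation_edge 3 parabola (fan parabola 3) a b \<Longrightarrow> edge X 3 x a b = G a b"
  proof (rule two_segal_realize[OF X _ P T, of G])
    fix i j k :: nat assume ijk: "i < j" "j < k" "k \<le> 3" "convex hull {parabola i, parabola j, parabola k} \<in> fan parabola 3"
    then have "i = 0" "k = Suc j" using fan_triangle_iff[OF P ijk(1-3)] by auto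
    with ijk consider "i = 0" "j = 1" "k = 2" | "i = 0" "j = 2" "k = 3" by force
    then show "pmul K (G i j) (G j k) = Some (G i k)" using assms by cases (auto simp: G_def)
  qed (auto simp: G_def)
  have "convex hull {parabola 0, parabola 1, parabola 2} \<in> fan parabola 3"
    "convex hull {parabola 0, parabola 2, parabola 3} \<in> fan parabola 3"
    using fan_triangle_iff[OF P, of 0 1 2] fan_triangle_iff[OF P, of 0 2 3] by auto
  note t = triangulation_edge_triple[OF _ _ _ this(1), of 3] triangulation_edge_triple[OF _ _ _ this(2), of 3]
  have "edge X 3 x 0 1 = a" "edge X 3 x 1 2 = b" "edge X 3 x 2 3 = c" "edge X 3 x 0 3 = d"
    using e t by (auto simp: G_def)
  then show ?thesis using edge_pmul[OF x, of 1 2 3] edge_pmul[OF x, of 0 1 3] by simp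
qed

lemma K_assoc_left:
  assumes X: "two_segal X" and "pmul K b c = Some u" "pmul K a u = Some d"
  shows "omul K (pmul K a b) (Some c) = Some d"
proof -
  \<comment> \<open>Now the diagonal 13 carries \<open>u\<close>, and the value \<open>b\<close> on
    02 is the filler.\<close>
  define G where "G = (\<lambda>i j :: nat. if i = j then pone K else if j = 1 then a else if j = 2 then b
    else if i = 2 then c else if i = 1 then u else d)"
  obtain p \<T> where P: "convex_polygon 3 p" and T: "polygon_triangulation 3 p \<T>"
    and mem: "convex hull {p 0, p 1, p 3} \<in> \<T>" "convex hull {p 1, p 2, p 3} \<in> \<T>"
    and only: "\<And>i j k. i < j \<Longrightarrow> j < k \<Longrightarrow> k \<le> 3 \<Longrightarrow> convex hull {p i, p j, p k} \<in> \<T> \<Longrightarrow>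
      (i = 0 \<and> j = 1 \<and> k = 3) \<or> (i = 1 \<and> j = 2 \<and> k = 3)"
    using square_other_diagonal by blast
  obtain x where x: "x \<in> simp X 3"
    and e: "\<And>a b. triangulation_edge 3 p \<T> a b \<Longrightarrow> edge X 3 x a b = G a b"
  proof (rule two_segal_realize[OF X _ P T, of G])
    fix i j k :: nat assume "i < j" "j < k" "k \<le> 3" "convex hull {p i, p j, p k} \<in> \<T>"
    then consider "i = 0" "j = 1" "k = 3" | "i = 1" "j = 2" "k = 3" using only by blast
    then show "pmul K (G i j) (G j k) = Some (G i k)" using assms by cases (auto simp: G_def)
  qed (auto simp: G_def)
  note t = triangulation_edge_triple[OF _ _ _ mem(1), of 3] triangulation_edge_triple[OF _ _ _ mem(2), of 3]
  have "edge X 3 x 0 1 = a" "edge X 3 x 1 2 = b" "edge X 3 x 2 3 = c" "edge X 3 x 0 3 = d"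
    using e t by (auto simp: G_def)
  then show ?thesis using edge_pmul[OF x, of 0 1 2] edge_pmul[OF x, of 0 2 3] by simp
qed

lemma K_assoc:
  assumes X: "two_segal X"
  shows "pm_assoc K"
  unfolding pm_assoc_def
proof (intro allI)
  fix a b c
  have "omul K (Some a) (pmul K b c) = Some d \<longleftrightarrow> omul K (pmul K a b) (Some c) = Some d" for d
  proof
    assume "omul K (Some a) (pmul K b c) = Some d"
    then show "omul K (pmul K a b) (Some c) = Some d"
      using K_assoc_left[OF X] by (cases "pmul K b c") auto
  next
    assume "omul K (pmul K a b) (Some c) = Some d"
    then show "omul K (Some a) (pmul K b c) = Some d"
      using K_assoc_right[OF X] by (cases "pmul K a b") auto
  qed
  then show "omul K (pmul K a b) (Some c) = omul K (Some a) (pmul K b c)"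
    by (metis option.exhaust)
qed

lemma K_monoid: "two_segal X \<Longrightarrow> partial_monoid K"
  by (intro partial_monoidI K_unital K_assoc)

text \<open>Only the spine has to be matched, since it determines \<open>g\<close>. For
  \<open>n = 2\<close> a filler exists by the definition of the product; the 2-Segal condition takes
  over from \<open>n = 3\<close>.\<close>

lemma edge_DD_hom_surj:
  assumes X: "two_segal X" and g: "g \<in> pm_hom (DD n) K"
  shows "\<exists>x\<in>simp X n. DD_hom_of n (edge X n x) = g"
proof -
  have "\<exists>x\<in>simp X n. \<forall>i<n. edge X n x i (Suc i) = g (dm i (Suc i))"
  proof -
    consider "n = 0" | "n = 1" | "n = 2" | "n \<ge> 3" by linarith
    then show ?thesis
    proof cases
      case 1
      then show ?thesis using reduced by (auto simp: reduced_sset_def is_singleton_def)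
    next
      case 2
      have "g (dm 0 1) \<in> simp X 1" using DD_hom_elems[OF g, of 0 1] 2 by (simp add: elems_K)
      then show ?thesis using 2 edge_self by (intro bexI[of _ "g (dm 0 1)"]) (auto simp: One_nat_def[symmetric])
    next
      case 3
      then have "pmul K (g (dm 0 1)) (g (dm 1 2)) = Some (g (dm 0 2))"
        using DD_hom_pmul[OF g, of 0 1 2] by simp
      then obtain \<sigma> where "\<sigma> \<in> simp X 2" "edge X 2 \<sigma> 0 1 = g (dm 0 1)" "edge X 2 \<sigma> 1 2 = g (dm 1 2)"
        unfolding pmul_K_iff by blast
      then show ?thesis using 3
        by (intro bexI[of _ \<sigma>]) (auto dest!: less_2_cases simp: One_nat_def[symmetric])
    next
      case 4
      \<comment> \<open>Labels are read off from \<open>g\<close>, so the condition on each triangle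
        of the fan is a product in \<open>DD n\<close>.\<close>
      have P: "convex_polygon n parabola" by (rule convex_polygon_parabola)
      have T: "polygon_triangulation n parabola (fan parabola n)" using 4 by (intro fan_triangulation[OF P]) simp
      obtain x where "x \<in> simp X n"
        "\<And>a b. triangulation_edge n parabola (fan parabola n) a b \<Longrightarrow> edge X n x a b = g (dm a b)"
      proof (rule two_segal_realize[OF X 4 P T, of "\<lambda>a b. g (dm a b)"])
        show "pmul K (g (dm i j)) (g (dm j k)) = Some (g (dm i k))" if "i < j" "j < k" "k \<le> n" for i j k
          using that by (intro DD_hom_pmul[OF g]) auto
      qed (use DD_hom_DOne[OF g] in auto)
      then show ?thesis using triangulation_spine_edge[OF P T] 4 by (intro bexI[of _ x]) auto
    qed
  qed
  then obtain x where x: "x \<in> simp X n" "\<And>i. i < n \<Longrightarrow> edge X n x i (Suc i) = g (dm i (Suc i))" by blast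
  have "DD_hom_of n (edge X n x) = g"
    by (rule DD_hom_eq_spineI[OF edge_DD_hom[OF x(1)] g]) (simp add: edge_DD_hom_dm[OF x(1)] x(2))
  with x(1) show ?thesis by blast
qed

lemma iso_nerve_K:
  assumes X: "two_segal X"
  shows "sset_iso X (nerve K)"
proof (rule sset_isoI)
  show "act (nerve K) n k \<phi> x \<in> simp (nerve K) n"
    if "\<phi> \<in> delta_hom n k" "x \<in> simp (nerve K) k" for n k \<phi> x
    using that by (rule act_closed[OF simplicial_set_nerve])
  let ?f = "\<lambda>n. \<lambda>x\<in>simp X n. DD_hom_of n (edge X n x)"
  show "?f \<in> sset_hom X (nerve K)"
  proof (rule sset_homI)
    fix n k \<phi> x assume *: "\<phi> \<in> delta_hom n k" "x \<in> simp X k"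
    note c = act_closed[OF simplicial *]
    have "DD_hom_of n (edge X n (act X n k \<phi> x)) = act (nerve K) n k \<phi> (DD_hom_of k (edge X k x))"
    proof (rule DD_hom_eqI[OF edge_DD_hom[OF c] act_nerve_closed[OF *(1) edge_DD_hom[OF *(2)]]])
      fix i j assume ij: "i < j" "j \<le> n"
      then show "DD_hom_of n (edge X n (act X n k \<phi> x)) (dm i j)
          = act (nerve K) n k \<phi> (DD_hom_of k (edge X k x)) (dm i j)"
        using delta_hom_le[OF *(1), of j] delta_hom_mono[OF *(1), of i j]
        by (simp add: edge_DD_hom_dm[OF c] act_nerve_dm[OF *(1)] edge_DD_hom_dm[OF *(2)] edge_act[OF *])
    qed
    then show "?f n (act X n k \<phi> x) = act (nerve K) n k \<phi> (?f k x)" using c *(2) by simp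
  qed (auto intro: edge_DD_hom)
  fix n
  show "bij_betw (?f n) (simp X n) (simp (nerve K) n)"
    unfolding bij_betw_def
  proof
    show "inj_on (?f n) (simp X n)"
    proof (rule inj_onI)
      fix x y assume xy: "x \<in> simp X n" "y \<in> simp X n" and eq: "?f n x = ?f n y"
      then have "DD_hom_of n (edge X n x) = DD_hom_of n (edge X n y)" by simp
      then show "x = y"
        using edge_DD_hom_dm[OF xy(1)] edge_DD_hom_dm[OF xy(2)]
        by (intro edges_inj[OF xy]) (metis Suc_leI lessI less_imp_le)
    qed
    show "?f n ` simp X n = simp (nerve K) n"
      using edge_DD_hom edge_DD_hom_surj[OF X] by (fastforce simp: image_iff)
  qed
qed (rule act_closed[OF simplicial])

end

theorem proposition4p9:
  fixes M :: "'a pmagma" and N :: "'b pmagma" and L :: "'c pmagma" and X :: "'x sset"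
  assumes "partial_monoid M" and "partial_monoid N" and "partial_monoid L"
    and "simplicial_set X"
  shows "simplicial_set (nerve M)
    \<and> nerve_map M (pm_id M) = sset_id (nerve M)
    \<and> (\<forall>f\<in>pm_hom M N. \<forall>g\<in>pm_hom N L.
         nerve_map M (pm_comp M g f) = sset_comp (nerve M) (nerve_map N g) (nerve_map M f))
    \<and> bij_betw (nerve_map M) (pm_hom M N) (sset_hom (nerve M) (nerve N))
    \<and> (sset_iso (nerve M) X \<longrightarrow> spiny X \<and> reduced_sset X \<and> two_segal X)
    \<and> ((\<exists>K :: 'x pmagma. partial_monoid K \<and> sset_iso (nerve K) X)
         \<longleftrightarrow> spiny X \<and> reduced_sset X \<and> two_segal X)"
proof -
  have unital: "partial_unital_magma M"
    using assms(1) by (simp add: partial_monoid_def)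
  \<comment> \<open>Polymorphic in the element type, as it is applied both to \<open>M\<close> and
    to monoids on the type of \<open>X\<close>.\<close>
  have nec: "spiny X \<and> reduced_sset X \<and> two_segal X"
    if "partial_monoid K" "sset_iso (nerve K) X" for K :: "'k pmagma"
  proof -
    have K: "partial_unital_magma K" using that(1) by (simp add: partial_monoid_def)
    show ?thesis
      using spiny_iso[OF that(2) spiny_nerve assms(4)] reduced_iso[OF that(2) reduced_nerve[OF K]]
        two_segal_iso[OF that(2) two_segal_nerve[OF K partial_monoid_assoc[OF that(1)]] assms(4)]
      by blast
  qed
  \<comment> \<open>The monoid can live on the simplex type of \<open>X\<close>, since its elements
    are edges of \<open>X\<close>.\<close>
  have suff: "\<exists>K :: 'x pmagma. partial_monoid K \<and> sset_iso (nerve K) X"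
    if "spiny X" "reduced_sset X" "two_segal X"
  proof -
    interpret spiny_reduced X using assms(4) that(1,2) by unfold_locales
    show ?thesis using K_monoid[OF that(3)] sset_iso_sym[OF iso_nerve_K[OF that(3)]] by blast
  qed
  show ?thesis
    using simplicial_set_nerve[of M] nerve_map_id[of M] nerve_map_bij[OF unital] nec[OF assms(1)]
    by (intro conjI ballI impI iffI) (auto intro: nerve_map_comp dest: nec suff)
qed

end
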